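(* Suppose that for some $\theta\ge1$ and every $\varepsilon>0$, $$\int_X^{2X}|B(\tfrac12+it)|^2\,dt \ll_\varepsilon X^{\theta+\varepsilon}\qquad (X\to\infty).$$ Then for every $\varepsilon>0$, $\Delta(x)\ll_\varepsilon x^{\frac{\theta}{\theta+1}+\varepsilon}$ as $x\to\infty$.
   Context: Let $\varphi(z)$ be a holomorphic cusp form of weight $\kappa$ for the full modular group $SL(2,\mathbb{Z})$ with Fourier coefficients $a(n)$, which is a normalized eigenfunction of all Hecke operators $T(n)$ (so $a(1)=1$ and $T(n)\varphi=a(n)\varphi$). Define $c_n = n^{1-\kappa}\sum_{m^2\mid n} m^{2(\kappa-1)}|a(n/m^2)|^2$ and the Rankin–Selberg series $Z(s)=\sum_{n\ge1}c_nn^{-s}$ ($\Re s>1$). One has $Z(s)=\zeta(s)B(s)$ where $B(s)=\sum_{n\ge1}b_nn^{-s}$ is a Dirichlet series (of degree three in the Selberg class) holomorphic for $\Re s>0$; $\zeta$ is the Riemann zeta-function. Let $C>0$ be the residue of $Z(s)$ at its simple pole $s=1$, and $\Delta(x)=\sum_{n\le x}c_n - Cx$. *)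

theory Defs
  imports
    "HOL-Complex_Analysis.Complex_Analysis"
    "HOL-Number_Theory.Prime_Powers"
    "HOL-Library.Landau_Symbols"
begin

definition upper_half_plane :: "complex set" where
  "upper_half_plane = {z. Im z > 0}"

text \<open>
  A Fourier expansion without a constant term is holomorphy and vanishing at the cusp
  of the full modular group.
\<close>

definition cusp_form_with_coeffs :: "int \<Rightarrow> (complex \<Rightarrow> complex) \<Rightarrow> (nat \<Rightarrow> complex) \<Rightarrow> bool" where
  "cusp_form_with_coeffs \<kappa> \<phi> a \<longleftrightarrow>
     \<phi> holomorphic_on upper_half_plane \<and>
     (\<forall>p q r s :: int. \<forall>z\<in>upper_half_plane. p * s - q * r = 1 \<longrightarrow>
        \<phi> ((of_int p * z + of_int q) / (of_int r * z + of_int s)) =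
          (of_int r * z + of_int s) powi \<kappa> * \<phi> z) \<and>
     (\<forall>z\<in>upper_half_plane.
        (\<lambda>n. a (Suc n) * exp (2 * of_real pi * \<i> * of_nat (Suc n) * z)) sums \<phi> z)"

definition hecke_operator :: "int \<Rightarrow> nat \<Rightarrow> (complex \<Rightarrow> complex) \<Rightarrow> complex \<Rightarrow> complex" where
  "hecke_operator \<kappa> n f z =
     of_nat n powi (\<kappa> - 1) *
       (\<Sum>d | d dvd n. of_nat d powi (- \<kappa>) *
         (\<Sum>b<d. f ((of_nat (n div d) * z + of_nat b) / of_nat d)))"

definition normalized_hecke_eigenform ::
    "int \<Rightarrow> (complex \<Rightarrow> complex) \<Rightarrow> (nat \<Rightarrow> complex) \<Rightarrow> bool" where
  "normalized_hecke_eigenform \<kappa> \<phi> a \<longleftrightarrow>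
     cusp_form_with_coeffs \<kappa> \<phi> a \<and> a 1 = 1 \<and>
     (\<forall>n\<ge>1. \<forall>z\<in>upper_half_plane. hecke_operator \<kappa> n \<phi> z = a n * \<phi> z)"

definition rankin_selberg_coeff :: "int \<Rightarrow> (nat \<Rightarrow> complex) \<Rightarrow> nat \<Rightarrow> real" where
  "rankin_selberg_coeff \<kappa> a n =
     of_nat n powi (1 - \<kappa>) *
       (\<Sum>m | m \<ge> 1 \<and> m ^ 2 dvd n.
          of_nat m powi (2 * (\<kappa> - 1)) * (norm (a (n div m ^ 2)))\<^sup>2)"

definition has_dirichlet_series :: "(nat \<Rightarrow> complex) \<Rightarrow> complex \<Rightarrow> complex \<Rightarrow> bool" where
  "has_dirichlet_series f s v \<longleftrightarrow> (\<lambda>n. f (Suc n) * of_nat (Suc n) powr (- s)) sums v"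

text \<open>
  The summand is \<open>n\<^sup>-\<^sup>s - \<integral>x\<^sup>-\<^sup>s dx\<close>, with the integral over \<open>[n, n+1]\<close>. The series converges for
  \<open>Re s > 0\<close>, and the definition is meant for \<open>Re s > 0\<close>, \<open>s \<noteq> 1\<close> only; the lemmas
  \<open>riemann_zeta_dirichlet_series\<close> and \<open>holomorphic_riemann_zeta\<close> below identify it there
  with the continuation of the usual Dirichlet series.
\<close>

definition zeta_summand :: "nat \<Rightarrow> complex \<Rightarrow> complex" where
  "zeta_summand n s =
     of_nat n powr (- s) - (of_nat (Suc n) powr (1 - s) - of_nat n powr (1 - s)) / (1 - s)"

definition riemann_zeta :: "complex \<Rightarrow> complex" where
  "riemann_zeta s = 1 / (s - 1) + (\<Sum>n. zeta_summand (Suc n) s)"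

lemma norm_Suc_powr: "norm ((of_nat (Suc n) :: complex) powr z) = real (Suc n) powr Re z"
  by (subst norm_powr_real_powr) auto

lemma riemann_zeta_dirichlet_series:
  assumes "Re s > 1"
  shows "has_dirichlet_series (\<lambda>_. 1) s (riemann_zeta s)"
proof -
  have s1: "s \<noteq> 1" using assms by auto
  define g where "g n = (of_nat (Suc n) :: complex) powr (1 - s)" for n
  have "summable (\<lambda>n. real n powr (- Re s))"
    using assms by (subst summable_real_powr_iff) auto
  hence "summable (\<lambda>n. real (Suc n) powr (- Re s))"
    by (subst summable_Suc_iff)
  hence "summable (\<lambda>n. norm ((of_nat (Suc n) :: complex) powr (- s)))"
    by (simp only: norm_Suc_powr uminus_complex.sel)
  hence sm: "summable (\<lambda>n. (of_nat (Suc n) :: complex) powr (- s))"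
    by (rule summable_norm_cancel)
  have "(\<lambda>n. real (Suc n) powr (1 - Re s)) \<longlonglongrightarrow> 0"
    using assms by (intro tendsto_neg_powr filterlim_compose[OF filterlim_real_sequentially] filterlim_Suc) auto
  hence "(\<lambda>n. norm (g n)) \<longlonglongrightarrow> 0"
    by (simp only: g_def norm_Suc_powr minus_complex.sel one_complex.sel)
  hence "g \<longlonglongrightarrow> 0" by (simp add: tendsto_norm_zero_iff)
  hence "(\<lambda>n. g (Suc n) - g n) sums (0 - g 0)" by (rule telescope_sums)
  hence tel: "(\<lambda>n. (g (Suc n) - g n) / (1 - s)) sums ((0 - g 0) / (1 - s))"
    by (rule sums_divide)
  have "(\<lambda>n. zeta_summand (Suc n) s) sums
      ((\<Sum>n. (of_nat (Suc n) :: complex) powr (- s)) - (0 - g 0) / (1 - s))"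
    unfolding zeta_summand_def using sums_diff[OF summable_sums[OF sm] tel]
    by (simp only: g_def)
  hence "riemann_zeta s = 1 / (s - 1) +
      ((\<Sum>n. (of_nat (Suc n) :: complex) powr (- s)) - (0 - g 0) / (1 - s))"
    unfolding riemann_zeta_def by (simp add: sums_iff)
  also have "\<dots> = (\<Sum>n. (of_nat (Suc n) :: complex) powr (- s))"
  proof -
    have "(0 - g 0) / (1 - s) = 1 / (s - 1)"
      using s1 by (simp add: g_def divide_simps)
    thus ?thesis by simp
  qed
  finally show ?thesis
    using sm by (simp add: has_dirichlet_series_def summable_sums del: of_nat_Suc)
qed

lemma norm_zeta_summand_le:
  assumes "Re s > 0" "s \<noteq> 1" "n \<ge> 1"
  shows "norm (zeta_summand n s) \<le> norm s * real n powr (- Re s - 1)"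
proof -
  define N where "N = (of_nat n :: complex)"
  define h where "h u = u * N powr (- s) - (N + u) powr (1 - s) / (1 - s)" for u
  have seg: "\<exists>t. 0 \<le> t \<and> t \<le> 1 \<and> u = of_real t" if "u \<in> closed_segment 0 1" for u :: complex
    using that by (auto simp: in_segment scaleR_conv_of_real)
  have pos: "N + of_real t = of_real (real n + t)" "real n + t > 0" if "0 \<le> t" for t
    using assms that by (auto simp: N_def)
  have nn: "N + u \<notin> \<real>\<^sub>\<le>\<^sub>0" if "u \<in> closed_segment 0 1" for u
    using seg[OF that] assms(3) by (auto simp: N_def complex_nonpos_Reals_iff)
  have dh: "(h has_field_derivative (N powr (- s) - (N + u) powr (- s))) (at u within closed_segment 0 1)"
    if "u \<in> closed_segment 0 1" for u
  proof -
    have "((\<lambda>u. (N + u) powr (1 - s)) has_field_derivative (1 - s) * (N + u) powr (- s))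
            (at u within closed_segment 0 1)"
      using nn[OF that] by (auto intro!: derivative_eq_intros)
    hence "((\<lambda>u. (N + u) powr (1 - s) / (1 - s)) has_field_derivative
            (1 - s) * (N + u) powr (- s) / (1 - s)) (at u within closed_segment 0 1)"
      by (rule DERIV_cdivide)
    hence "((\<lambda>u. (N + u) powr (1 - s) / (1 - s)) has_field_derivative (N + u) powr (- s))
            (at u within closed_segment 0 1)"
      using assms(2) by simp
    moreover have "((\<lambda>u. u * N powr (- s)) has_field_derivative N powr (- s))
            (at u within closed_segment 0 1)"
      by (auto intro!: derivative_eq_intros)
    ultimately show ?thesis unfolding h_def by (intro DERIV_diff)
  qed
  have bd: "norm (N powr (- s) - (N + u) powr (- s)) \<le> norm s * real n powr (- Re s - 1)"
    if u: "u \<in> closed_segment 0 1" for u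
  proof -
    have "norm ((N + 0) powr (- s) - (N + u) powr (- s))
            \<le> norm s * real n powr (- Re s - 1) * norm (0 - u)"
    proof (rule field_differentiable_bound[where S = "closed_segment 0 1"
              and f = "\<lambda>u. (N + u) powr (- s)" and f' = "\<lambda>u. - s * (N + u) powr (- s - 1)"])
      fix v :: complex assume v: "v \<in> closed_segment 0 1"
      show "((\<lambda>u. (N + u) powr (- s)) has_field_derivative - s * (N + v) powr (- s - 1))
              (at v within closed_segment 0 1)"
        using nn[OF v] by (auto intro!: derivative_eq_intros)
      obtain t where t: "0 \<le> t" "t \<le> 1" "v = of_real t" using seg[OF v] by blast
      have "norm ((N + v) powr (- s - 1)) = (real n + t) powr (- Re s - 1)"
        unfolding t(3) pos(1)[OF t(1)] using pos(2)[OF t(1)]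
        by (subst norm_powr_real_powr) auto
      also have "\<dots> \<le> real n powr (- Re s - 1)"
        using assms t by (intro powr_mono2') auto
      finally show "norm (- s * (N + v) powr (- s - 1)) \<le> norm s * real n powr (- Re s - 1)"
        by (simp add: norm_mult mult_left_mono)
    qed (use u in auto)
    moreover have "norm u \<le> 1" using seg[OF u] by auto
    hence "norm s * real n powr (- Re s - 1) * norm (0 - u) \<le> norm s * real n powr (- Re s - 1) * 1"
      by (intro mult_left_mono) auto
    ultimately show ?thesis by simp
  qed
  have "norm (h 1 - h 0) \<le> norm s * real n powr (- Re s - 1) * norm (1 - 0 :: complex)"
    by (rule field_differentiable_bound[OF _ dh bd]) auto
  moreover have "h 1 - h 0 = zeta_summand n s"
    by (simp add: h_def zeta_summand_def N_def diff_divide_distrib add.commute)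
  ultimately show ?thesis by simp
qed

lemma holomorphic_riemann_zeta: "riemann_zeta holomorphic_on {s. Re s > 0} - {1}"
proof -
  let ?S = "{s. Re s > 0} - {1 :: complex}"
  have op: "open ?S" by (intro open_Diff open_halfspace_Re_gt) auto
  have "(\<lambda>s. \<Sum>n. zeta_summand (Suc n) s) holomorphic_on ?S"
  proof (rule holomorphic_uniform_sequence[OF op])
    show "(\<lambda>s. \<Sum>n<N. zeta_summand (Suc n) s) holomorphic_on ?S" for N
      unfolding zeta_summand_def by (intro holomorphic_intros) (auto simp: complex_nonpos_Reals_iff)
  next
    fix s :: complex assume "s \<in> ?S"
    then obtain d where d: "d > 0" "cball s d \<subseteq> ?S"
      using op open_contains_cball by blast
    have "s - of_real d \<in> cball s d" using d(1) by (simp add: dist_norm)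
    hence "s - of_real d \<in> ?S" using d(2) by blast
    hence \<sigma>: "Re s - d > 0" by simp
    have "uniform_limit (cball s d) (\<lambda>N s. \<Sum>n<N. zeta_summand (Suc n) s)
            (\<lambda>s. \<Sum>n. zeta_summand (Suc n) s) sequentially"
    proof (rule Weierstrass_m_test)
      fix n w assume w: "w \<in> cball s d"
      hence w': "Re w > 0" "w \<noteq> 1" using d by auto
      have dw: "norm (s - w) \<le> d" using w by (simp add: dist_norm)
      have "norm w \<le> norm s + d"
        using dw norm_triangle_ineq4[of s "s - w"] by simp
      moreover have "Re w \<ge> Re s - d"
        using dw abs_Re_le_cmod[of "s - w"] by simp
      hence "real (Suc n) powr (- Re w - 1) \<le> real (Suc n) powr (- (Re s - d) - 1)"
        by (intro powr_mono) auto
      ultimately have "norm w * real (Suc n) powr (- Re w - 1)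
          \<le> (norm s + d) * real (Suc n) powr (- (Re s - d) - 1)"
        using d(1) by (intro mult_mono) auto
      thus "norm (zeta_summand (Suc n) w) \<le> (norm s + d) * real (Suc n) powr (- (Re s - d) - 1)"
        using norm_zeta_summand_le[OF w', of "Suc n"] by simp
    next
      have "summable (\<lambda>n. real n powr (- (Re s - d) - 1))"
        using \<sigma> by (subst summable_real_powr_iff) auto
      hence "summable (\<lambda>n. real (Suc n) powr (- (Re s - d) - 1))"
        by (subst summable_Suc_iff)
      thus "summable (\<lambda>n. (norm s + d) * real (Suc n) powr (- (Re s - d) - 1))"
        by (rule summable_mult)
    qed
    thus "\<exists>d>0. cball s d \<subseteq> ?S \<and> uniform_limit (cball s d)
            (\<lambda>N s. \<Sum>n<N. zeta_summand (Suc n) s) (\<lambda>s. \<Sum>n. zeta_summand (Suc n) s) sequentially"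
      using d by blast
  qed
  thus ?thesis
    unfolding riemann_zeta_def by (intro holomorphic_intros) auto
qed

text \<open>
  The Selberg class: \<open>f\<close> is the coefficient sequence and \<open>F\<close> the continued \<open>L\<close>-function. Since
  \<^const>\<open>Gamma\<close> is \<open>0\<close> at its poles, the functional equation is stated away from the poles of the
  gamma factors (and away from \<open>0\<close> and \<open>1\<close>, where \<open>F\<close> may have a pole on one of the two sides).
\<close>

definition completed_L ::
    "real \<Rightarrow> nat \<Rightarrow> (nat \<Rightarrow> real) \<Rightarrow> (nat \<Rightarrow> complex) \<Rightarrow> (complex \<Rightarrow> complex) \<Rightarrow> complex \<Rightarrow> complex" where
  "completed_L Q r lam mu F s =
     of_real Q powr s * (\<Prod>j<r. Gamma (of_real (lam j) * s + mu j)) * F s"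

definition selberg_functional_equation :: "(complex \<Rightarrow> complex) \<Rightarrow> real \<Rightarrow> bool" where
  "selberg_functional_equation F d \<longleftrightarrow>
     (\<exists>Q r lam mu \<omega>.
        Q > 0 \<and> norm \<omega> = 1 \<and> (\<forall>j<r. lam j > 0 \<and> Re (mu j) \<ge> 0) \<and>
        d = 2 * (\<Sum>j<r. lam j) \<and>
        (\<forall>s. s \<noteq> 0 \<and> s \<noteq> 1 \<and>
             (\<forall>j<r. of_real (lam j) * s + mu j \<notin> \<int>\<^sub>\<le>\<^sub>0 \<and>
                    of_real (lam j) * (1 - cnj s) + mu j \<notin> \<int>\<^sub>\<le>\<^sub>0) \<longrightarrow>
             completed_L Q r lam mu F s = \<omega> * cnj (completed_L Q r lam mu F (1 - cnj s))))"

definition selberg_class_of_degree ::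
    "real \<Rightarrow> (nat \<Rightarrow> complex) \<Rightarrow> (complex \<Rightarrow> complex) \<Rightarrow> bool" where
  "selberg_class_of_degree d f F \<longleftrightarrow>
     (\<forall>s. Re s > 1 \<longrightarrow>
        summable (\<lambda>n. norm (f (Suc n) * of_nat (Suc n) powr (- s))) \<and>
        has_dirichlet_series f s (F s)) \<and>
     (\<exists>(k :: nat) G K \<rho>. G holomorphic_on UNIV \<and>
        (\<forall>s. s \<noteq> 1 \<longrightarrow> G s = (s - 1) ^ k * F s) \<and>
        (\<forall>s. norm (G s) \<le> K * exp (norm s powr \<rho>))) \<and>
     selberg_functional_equation F d \<and>
     (\<forall>\<epsilon>>0. (\<lambda>n. norm (f n)) \<in> O(\<lambda>n. real n powr \<epsilon>)) \<and>
     (\<exists>g \<eta>. \<eta> < 1 / 2 \<and> (\<forall>n. \<not> primepow n \<longrightarrow> g n = 0) \<and>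
        (\<lambda>n. norm (g n)) \<in> O(\<lambda>n. real n powr \<eta>) \<and>
        (\<forall>s. Re s > 1 \<longrightarrow> (\<exists>L. has_dirichlet_series g s L \<and> F s = exp L)))"

definition rankin_selberg_Delta :: "int \<Rightarrow> (nat \<Rightarrow> complex) \<Rightarrow> real \<Rightarrow> real \<Rightarrow> real" where
  "rankin_selberg_Delta \<kappa> a C x =
     (\<Sum>n | 1 \<le> n \<and> real n \<le> x. rankin_selberg_coeff \<kappa> a n) - C * x"

end

(*
  Since the coefficients c(n) are nonnegative, their summatory function S is monotone and is sandwiched
  between smoothed versions of itself at distance x/T. The smoothed sum is the integral over Re s = 2
  of Z(s) x^s/s times a kernel that is O((T/|s|)^k) for an arbitrary fixed k. Moving the line to
  Re s = 1/2 picks up C x + O(x/T) from the pole at s = 1. On the critical line the kernel is at most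
  a constant times (T/|s|)^beta with beta = (theta-1)/2 + eps, so the remaining integral is
  O(x^(1/2) T^beta) once |zeta B| |s|^(-1-beta) is integrable; by AM-GM this follows from the
  hypothesis on B and the mean square bound X^(1+eps) for zeta. Finally T = x^(1/(theta+1)).

  The mean square of zeta is obtained from (1 - 2^(1-s)) zeta(s) = sum of (-1)^(n-1) n^(-s): repeated
  summation by parts makes the tail n > X^(1+eps) bounded, and the square of the remaining
  Dirichlet polynomial is integrated term by term.
*)

theory Submission
  imports Defs "HOL-Probability.Sinc_Integral" "HOL-Real_Asymp.Real_Asymp"
begin

section \<open>Shifting vertical lines of integration\<close>

text \<open>The exponents are forced as follows. Over [X, 2X] the mean squares of zeta and B have
  exponents 1 and \<theta>, so |zeta B| integrates to about X^((1+\<theta>)/2) by Cauchy-Schwarz;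
  convergence against |s|^(-1-beta) then asks for beta > (\<theta>-1)/2. The errors x/T and x^(1/2)
  T^((\<theta>-1)/2) agree when T^((\<theta>+1)/2) = x^(1/2).

  Finite differences of truncated powers serve as the smoothing because both sides are explicit: the
  weight has a known support and values in [0, 1], and its transform comes from the residue of
  e^(sv)/s^(k+1) at 0.

  For zeta, the alternating signs make each summation by parts gain a factor of order |s|/n without
  producing a main term, so a polynomial only slightly longer than X is enough; at that length the
  off-diagonal terms cost no more than a logarithm beyond the length.\<close>

lemma integrable_inverse_1_plus_sq: "integrable lborel (\<lambda>x::real. inverse (1 + x\<^sup>2))"
  using integrable_inverse_1_plus_square
  by (simp add: set_integrable_def einterval_eq)

text \<open>Contour integrals along segments come out as Henstock-Kurzweil integrals over [-T, T],
  whereas the later estimates use Lebesgue integrals over the whole line; dominated convergence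
  links the two.\<close>

lemma tendsto_integral_symmetric_interval:
  fixes f :: "real \<Rightarrow> complex"
  assumes f: "integrable lborel f"
  shows "((\<lambda>T. integral {-T..T} f) \<longlongrightarrow> (LINT t|lborel. f t)) at_top"
proof -
  have "((\<lambda>T. LINT t|lborel. indicator {-T..T} t *\<^sub>R f t) \<longlongrightarrow> (LINT t|lborel. f t)) at_top"
  proof (rule integral_dominated_convergence_at_top)
    show "f \<in> borel_measurable lborel" using f by auto
    show "(\<lambda>t. indicator {-T..T} t *\<^sub>R f t) \<in> borel_measurable lborel" for T
      using f by (intro borel_measurable_scaleR) auto
    show "integrable lborel (\<lambda>t. norm (f t))" using f by auto
    show "AE t in lborel. ((\<lambda>T. indicator {-T..T} t *\<^sub>R f t) \<longlongrightarrow> f t) at_top"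
    proof (intro AE_I2 tendsto_eventually)
      fix t :: real
      show "\<forall>\<^sub>F T in at_top. indicator {-T..T} t *\<^sub>R f t = f t"
        using eventually_ge_at_top[of "\<bar>t\<bar>"] by eventually_elim (auto simp: indicator_def)
    qed
    show "\<forall>\<^sub>F T in at_top. AE t in lborel. norm (indicator {-T..T} t *\<^sub>R f t) \<le> norm (f t)"
      by (auto simp: indicator_def)
  qed
  moreover have "(LINT t|lborel. indicator {-T..T} t *\<^sub>R f t) = integral {-T..T} f" for T
  proof -
    have "set_integrable lborel {-T..T} f"
      using f unfolding set_integrable_def by (intro integrable_mult_indicator) auto
    from set_borel_integral_eq_integral(2)[OF this] show ?thesis
      by (simp add: set_lebesgue_integral_def)
  qed
  ultimately show ?thesis by simp
qed

lemma contour_integral_rectpath: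
  assumes f: "continuous_on (path_image (rectpath (Complex a (-T)) (Complex b T))) f"
    and "a < b" "T > 0"
  shows "contour_integral (rectpath (Complex a (-T)) (Complex b T)) f =
    \<i> * (integral {-T..T} (\<lambda>t. f (Complex b t)) - integral {-T..T} (\<lambda>t. f (Complex a t))) +
    (contour_integral (linepath (Complex a (-T)) (Complex b (-T))) f +
     contour_integral (linepath (Complex b T) (Complex a T)) f)"
proof -
  let ?q1 = "Complex a (-T)" and ?q2 = "Complex b (-T)" and ?q3 = "Complex b T" and ?q4 = "Complex a T"
  have im: "path_image (rectpath ?q1 ?q3) =
      closed_segment ?q1 ?q2 \<union> closed_segment ?q2 ?q3 \<union> closed_segment ?q3 ?q4 \<union> closed_segment ?q4 ?q1"
    by (simp add: rectpath_def Let_def path_image_join Un_assoc)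
  have c: "continuous_on (closed_segment ?q1 ?q2) f" "continuous_on (closed_segment ?q2 ?q3) f"
     "continuous_on (closed_segment ?q3 ?q4) f" "continuous_on (closed_segment ?q4 ?q1) f"
    using f unfolding im by (auto elim: continuous_on_subset)
  hence ci: "f contour_integrable_on linepath ?q1 ?q2" "f contour_integrable_on linepath ?q2 ?q3"
     "f contour_integrable_on linepath ?q3 ?q4" "f contour_integrable_on linepath ?q4 ?q1"
    by (auto intro: contour_integrable_continuous_linepath)
  have "contour_integral (rectpath ?q1 ?q3) f = contour_integral (linepath ?q1 ?q2) f +
    (contour_integral (linepath ?q2 ?q3) f + (contour_integral (linepath ?q3 ?q4) f +
      contour_integral (linepath ?q4 ?q1) f))"
    using ci by (simp add: rectpath_def Let_def)
  moreover have "contour_integral (linepath ?q2 ?q3) f = \<i> * integral {-T..T} (\<lambda>t. f (Complex b t))"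
    using assms by (intro contour_integral_linepath_same_Re) auto
  moreover have "contour_integral (linepath ?q1 ?q4) f = \<i> * integral {-T..T} (\<lambda>t. f (Complex a t))"
    using assms by (intro contour_integral_linepath_same_Re) auto
  moreover have "contour_integral (linepath ?q4 ?q1) f = - contour_integral (linepath ?q1 ?q4) f"
    using c(4) by (rule contour_integral_reverse_linepath)
  ultimately show ?thesis by (simp add: algebra_simps)
qed

text \<open>Integrability on both lines makes the vertical sides of growing rectangles converge, and
  \<open>g\<close> controls the horizontal sides. The point \<open>p\<close> may be a regular point
  of \<open>f\<close>; the residue is then 0 and this becomes Cauchy's theorem for the
  strip.\<close>

lemma vertical_line_shift:
  fixes f :: "complex \<Rightarrow> complex"
  assumes S: "open S" "convex S" and p: "a < Re p" "Re p < b"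
    and sub: "{z. a \<le> Re z \<and> Re z \<le> b} \<subseteq> S"
    and f: "f holomorphic_on S - {p}"
    and ia: "integrable lborel (\<lambda>t. f (Complex a t))"
    and ib: "integrable lborel (\<lambda>t. f (Complex b t))"
    and g: "(g \<longlongrightarrow> 0) at_top"
    and fg: "\<forall>\<^sub>F T in at_top. \<forall>x\<in>{a..b}. norm (f (Complex x T)) \<le> g T \<and> norm (f (Complex x (-T))) \<le> g T"
  shows "(LINT t|lborel. f (Complex b t)) - (LINT t|lborel. f (Complex a t)) = 2 * of_real pi * residue f p"
proof -
  define V where "V c T = integral {-T..T} (\<lambda>t. f (Complex c t))" for c T
  define H where "H T = contour_integral (linepath (Complex a (-T)) (Complex b (-T))) f +
     contour_integral (linepath (Complex b T) (Complex a T)) f" for T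
  have ab: "a < b" using p by simp
  have rect: "path_image (rectpath (Complex a (-T)) (Complex b T)) \<subseteq> S - {p}"
    if T: "T > \<bar>Im p\<bar>" for T
  proof -
    have "path_image (rectpath (Complex a (-T)) (Complex b T)) =
        cbox (Complex a (-T)) (Complex b T) - box (Complex a (-T)) (Complex b T)"
      using ab T by (intro path_image_rectpath_cbox_minus_box) auto
    moreover have "cbox (Complex a (-T)) (Complex b T) \<subseteq> S"
      using sub by (auto simp: in_cbox_complex_iff)
    moreover have "p \<in> box (Complex a (-T)) (Complex b T)"
      using p T by (auto simp: in_box_complex_iff)
    ultimately show ?thesis by blast
  qed
  have cont: "continuous_on (path_image (rectpath (Complex a (-T)) (Complex b T))) f"
    if T: "T > \<bar>Im p\<bar>" for T
    using holomorphic_on_imp_continuous_on[OF f] rect[OF T] by (rule continuous_on_subset)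
  have main: "\<i> * (V b T - V a T) + H T = 2 * of_real pi * \<i> * residue f p" if T: "T > \<bar>Im p\<bar>" for T
  proof -
    let ?r = "rectpath (Complex a (-T)) (Complex b T)"
    have w: "winding_number ?r p = 1"
      using p T by (intro winding_number_rectpath) (auto simp: in_box_complex_iff)
    have "contour_integral ?r f = 2 * pi * \<i> * (\<Sum>q\<in>{p}. winding_number ?r q * residue f q)"
    proof (rule Residue_theorem[OF S(1)])
      show "connected S" using S(2) by (rule convex_connected)
      show "\<forall>z. z \<notin> S \<longrightarrow> winding_number ?r z = 0"
        using rect[OF T] S(2) by (auto intro!: winding_number_zero_outside[of _ S])
    qed (use f rect[OF T] in auto)
    thus ?thesis
      using contour_integral_rectpath[OF cont[OF T] ab] T w by (simp add: V_def H_def)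
  qed
  have "(H \<longlongrightarrow> 0) at_top"
  proof (rule Lim_null_comparison)
    show "((\<lambda>T. 2 * ((b - a) * g T)) \<longlongrightarrow> 0) at_top"
      by (auto intro!: tendsto_eq_intros g)
    show "\<forall>\<^sub>F T in at_top. norm (H T) \<le> 2 * ((b - a) * g T)"
      using fg eventually_gt_at_top[of "\<bar>Im p\<bar>"]
    proof eventually_elim
      case (elim T)
      have T0: "T > 0" using elim(2) by linarith
      have c: "continuous_on (closed_segment (Complex a (-T)) (Complex b (-T))) f"
           "continuous_on (closed_segment (Complex b T) (Complex a T)) f"
        using cont[OF elim(2)]
        by (auto simp: rectpath_def Let_def path_image_join elim!: continuous_on_subset)
      have gT: "g T \<ge> 0" using elim(1) ab norm_ge_zero[of "f (Complex a T)"]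
        by (meson atLeastAtMost_iff less_eq_real_def order_trans order_refl)
      have seg: "Im z = y \<and> Re z \<in> {a..b}"
        if "z \<in> closed_segment (Complex a y) (Complex b y)" for z y
        using that ab by (auto simp: closed_segment_same_Im closed_segment_eq_real_ivl)
      have bd: "norm (f z) \<le> g T"
        if "z \<in> closed_segment (Complex a y) (Complex b y)" "y = T \<or> y = -T" for z y
        using seg[OF that(1)] that(2) elim(1) complex_surj[of z] by metis
      have "norm (contour_integral (linepath (Complex a (-T)) (Complex b (-T))) f)
              \<le> g T * norm (Complex b (-T) - Complex a (-T))"
        using c(1) gT bd
        by (intro contour_integral_bound_linepath contour_integrable_continuous_linepath) auto
      moreover have "norm (contour_integral (linepath (Complex b T) (Complex a T)) f)
              \<le> g T * norm (Complex a T - Complex b T)"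
        using c(2) gT bd
        by (intro contour_integral_bound_linepath contour_integrable_continuous_linepath)
           (auto simp: closed_segment_commute)
      moreover have "norm (Complex b (-T) - Complex a (-T)) = b - a"
        "norm (Complex a T - Complex b T) = b - a"
        using ab by (simp_all add: cmod_def)
      ultimately show ?case
        unfolding H_def using norm_triangle_ineq[of "contour_integral (linepath (Complex a (-T)) (Complex b (-T))) f"
          "contour_integral (linepath (Complex b T) (Complex a T)) f"]
        by (simp add: mult.commute)
    qed
  qed
  hence "((\<lambda>T. \<i> * (V b T - V a T) + H T) \<longlongrightarrow>
      \<i> * ((LINT t|lborel. f (Complex b t)) - (LINT t|lborel. f (Complex a t))) + 0) at_top"
    unfolding V_def
    by (intro tendsto_intros tendsto_integral_symmetric_interval ia ib)
  moreover have "\<forall>\<^sub>F T in at_top. \<i> * (V b T - V a T) + H T = 2 * of_real pi * \<i> * residue f p"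
    using eventually_gt_at_top[of "\<bar>Im p\<bar>"] by eventually_elim (rule main)
  hence "((\<lambda>T. \<i> * (V b T - V a T) + H T) \<longlongrightarrow> 2 * of_real pi * \<i> * residue f p) at_top"
    by (rule tendsto_eventually)
  ultimately have "\<i> * ((LINT t|lborel. f (Complex b t)) - (LINT t|lborel. f (Complex a t))) + 0
      = 2 * of_real pi * \<i> * residue f p"
    by (intro tendsto_unique[OF trivial_limit_at_top_linorder])
  hence "\<i> * ((LINT t|lborel. f (Complex b t)) - (LINT t|lborel. f (Complex a t)))
      = \<i> * (2 * of_real pi * residue f p)" by (simp add: mult_ac)
  thus ?thesis using mult_cancel_left[of \<i>] by simp
qed

section \<open>Finite differences of truncated powers\<close>

text \<open>The value type is general because the operator is applied both to real truncated powers
  (for the kernel) and to complex powers \<open>x powr (- s)\<close> (for the alternating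
  series).\<close>

primrec fdiff :: "real \<Rightarrow> nat \<Rightarrow> (real \<Rightarrow> 'a::ab_group_add) \<Rightarrow> real \<Rightarrow> 'a" where
  "fdiff h 0 f = f"
| "fdiff h (Suc k) f = (\<lambda>v. fdiff h k f (v + h) - fdiff h k f v)"

lemma DERIV_fdiff:
  fixes F F' :: "real \<Rightarrow> real"
  assumes "\<And>v. (F has_real_derivative F' v) (at v)"
  shows "(fdiff h k F has_real_derivative fdiff h k F' v) (at v)"
proof (induction k arbitrary: v)
  case (Suc k)
  have "((\<lambda>v. fdiff h k F (v + h)) has_real_derivative fdiff h k F' (v + h)) (at v)"
    using Suc[of "v + h"] by (simp add: DERIV_shift)
  with Suc[of v] show ?case by (auto intro: DERIV_diff)
qed (use assms in simp)

text \<open>The inverse Laplace transform of 1/s^(k+1), usually written v_+^k / k!.\<close>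

definition trunc_pow :: "nat \<Rightarrow> real \<Rightarrow> real" where
  "trunc_pow k v = (if v \<ge> 0 then v ^ k / fact k else 0)"

text \<open>The condition k \<ge> 1 excludes v_+, which has a corner at 0. At v = 0 the difference
  quotient is squeezed by |h|^k.\<close>

lemma DERIV_trunc_pow:
  assumes "k \<ge> 1"
  shows "(trunc_pow (Suc k) has_real_derivative trunc_pow k v) (at v)"
proof -
  have D: "((\<lambda>v. v ^ Suc k / fact (Suc k)) has_real_derivative v ^ k / fact k) (at v)" for v :: real
  proof -
    have "((\<lambda>v. v ^ Suc k / fact (Suc k)) has_real_derivative (real (Suc k) * v ^ k) / fact (Suc k)) (at v)"
      using DERIV_pow[of "Suc k" v] by (intro DERIV_cdivide) (simp del: power_Suc of_nat_Suc)
    thus ?thesis by (simp del: power_Suc of_nat_Suc)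
  qed
  consider "v > 0" | "v < 0" | "v = 0" by linarith
  thus ?thesis
  proof cases
    case 1
    have "(trunc_pow (Suc k) has_real_derivative v ^ k / fact k) (at v)"
      using D by (rule has_field_derivative_transform_within_open[where S = "{0<..}"])
        (use 1 in \<open>auto simp: trunc_pow_def\<close>)
    thus ?thesis using 1 by (simp add: trunc_pow_def)
  next
    case 2
    have "(trunc_pow (Suc k) has_real_derivative 0) (at v)"
      by (rule has_field_derivative_transform_within_open[where S = "{..<0}" and f = "\<lambda>_. 0"])
        (use 2 in \<open>auto simp: trunc_pow_def\<close>)
    thus ?thesis using 2 by (simp add: trunc_pow_def)
  next
    case 3
    have "((\<lambda>h. trunc_pow (Suc k) h / h) \<longlongrightarrow> 0) (at 0)"
    proof (rule Lim_null_comparison)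
      show "((\<lambda>h::real. \<bar>h\<bar> ^ k) \<longlongrightarrow> 0) (at 0)"
        using assms by (auto intro!: tendsto_eq_intros)
      show "\<forall>\<^sub>F h in at 0. norm (trunc_pow (Suc k) h / h) \<le> \<bar>h\<bar> ^ k"
      proof (intro always_eventually allI)
        fix h :: real
        have "\<bar>h\<bar> ^ k / (fact k * (1 + real k)) \<le> \<bar>h\<bar> ^ k / 1"
          using fact_ge_1[of k, where ?'a = real] mult_mono[of 1 "fact k" 1 "1 + real k"]
          by (intro divide_left_mono) auto
        thus "norm (trunc_pow (Suc k) h / h) \<le> \<bar>h\<bar> ^ k"
          by (auto simp: trunc_pow_def abs_mult power_abs mult.commute)
      qed
    qed
    moreover have "trunc_pow (Suc k) 0 = 0" "trunc_pow k 0 = 0"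
      using assms by (simp_all add: trunc_pow_def)
    ultimately show ?thesis using 3 by (simp add: DERIV_def)
  qed
qed

text \<open>Divided by h^(k+1), the difference is the probability that v + h (U_0 + ... + U_k) \<ge>
  0 for independent U_i uniform on [0, 1]; hence the values in [0, 1] and the two ranges where it is
  constant. The proof replaces the integral by the mean value theorem.\<close>

lemma fdiff_trunc_pow_bounds:
  assumes "h > 0"
  shows "0 \<le> fdiff h (Suc k) (trunc_pow (Suc k)) v \<and> fdiff h (Suc k) (trunc_pow (Suc k)) v \<le> h ^ Suc k \<and>
    (v \<ge> 0 \<longrightarrow> fdiff h (Suc k) (trunc_pow (Suc k)) v = h ^ Suc k) \<and>
    (v \<le> - (real (Suc k) * h) \<longrightarrow> fdiff h (Suc k) (trunc_pow (Suc k)) v = 0)"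
proof (induction k arbitrary: v)
  case 0
  show ?case using assms by (auto simp: trunc_pow_def)
next
  case (Suc k)
  \<comment> \<open>One order of differencing is traded for a factor h at an intermediate point.
    That point lies less than h to the right of v, so the range of vanishing recedes by exactly one
    more h.\<close>
  obtain x where x: "v < x" "x < v + h"
    "fdiff h (Suc (Suc k)) (trunc_pow (Suc (Suc k))) v = h * fdiff h (Suc k) (trunc_pow (Suc k)) x"
  proof -
    have "\<exists>z>v. z < v + h \<and> fdiff h (Suc k) (trunc_pow (Suc (Suc k))) (v + h) -
        fdiff h (Suc k) (trunc_pow (Suc (Suc k))) v = (v + h - v) * fdiff h (Suc k) (trunc_pow (Suc k)) z"
      using assms by (intro MVT2 DERIV_fdiff DERIV_trunc_pow) auto
    thus ?thesis using that by auto
  qed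
  have "v \<le> - (real (Suc (Suc k)) * h) \<Longrightarrow> x \<le> - (real (Suc k) * h)"
    using x(2) by (simp add: algebra_simps)
  with x Suc[of x] assms show ?case
    by (auto simp del: fdiff.simps)
qed

section \<open>Inverse Mellin transforms of powers\<close>

lemma norm_inverse_power_le:
  fixes s :: complex
  assumes "\<bar>Re s\<bar> \<ge> 1" "k \<ge> 1"
  shows "norm (1 / s ^ Suc k) \<le> inverse (1 + (Im s)\<^sup>2)"
proof -
  have "1 \<le> (Re s)\<^sup>2" using assms(1) by (metis abs_le_square_iff abs_1 one_power2)
  hence sq: "(norm s)\<^sup>2 \<ge> 1 + (Im s)\<^sup>2" by (simp add: cmod_power2)
  have "norm s \<ge> 1" using assms(1) abs_Re_le_cmod[of s] by linarith
  hence "norm s ^ 2 \<le> norm s ^ Suc k" using assms(2) by (intro power_increasing) auto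
  with sq have "1 + (Im s)\<^sup>2 \<le> norm s ^ Suc k" by linarith
  moreover have "1 + (Im s)\<^sup>2 > 0" by (simp add: add_pos_nonneg)
  ultimately have "inverse (norm s ^ Suc k) \<le> inverse (1 + (Im s)\<^sup>2)"
    by (intro le_imp_inverse_le)
  thus ?thesis by (simp add: norm_divide norm_power inverse_eq_divide del: power_Suc)
qed

lemma integrable_vertical_over_power:
  assumes F: "continuous_on UNIV F" and bd: "\<And>t. norm (F t) \<le> M" and c: "\<bar>c\<bar> \<ge> 1" and k: "k \<ge> 1"
  shows "integrable lborel (\<lambda>t. F t / (Complex c t) ^ Suc k)"
proof (rule Bochner_Integration.integrable_bound)
  show "integrable lborel (\<lambda>t. M * inverse (1 + t\<^sup>2))"
    by (intro integrable_mult_right integrable_inverse_1_plus_sq)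
  have "Complex c t \<noteq> 0" for t using c by (auto simp: complex_eq_iff)
  hence "continuous_on UNIV (\<lambda>t. F t / (Complex c t) ^ Suc k)"
    using F by (intro continuous_intros) (auto simp: Complex_eq intro!: continuous_intros)
  thus "(\<lambda>t. F t / (Complex c t) ^ Suc k) \<in> borel_measurable lborel"
    by (simp add: borel_measurable_continuous_onI)
  have M: "M \<ge> 0" using bd[of 0] norm_ge_zero order_trans by blast
  show "AE t in lborel. norm (F t / (Complex c t) ^ Suc k) \<le> norm (M * inverse (1 + t\<^sup>2))"
  proof (intro AE_I2)
    fix t :: real
    have "norm (F t / (Complex c t) ^ Suc k) = norm (F t) * norm (1 / (Complex c t) ^ Suc k)"
      by (simp only: norm_mult[symmetric]) simp
    also have "\<dots> \<le> M * inverse (1 + t\<^sup>2)"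
      using norm_inverse_power_le[of "Complex c t" k] bd[of t] c k M by (intro mult_mono) auto
    finally show "norm (F t / (Complex c t) ^ Suc k) \<le> norm (M * inverse (1 + t\<^sup>2))"
      by simp
  qed
qed

lemma continuous_on_Complex [continuous_intros]:
  "continuous_on A (\<lambda>t. Complex c t)"
  by (simp add: Complex_eq continuous_intros)

lemma norm_exp_over_power_le:
  assumes "Re z * v \<le> M" "\<bar>Im z\<bar> \<ge> 1" "k \<ge> 1"
  shows "norm (exp (z * of_real v) / z ^ Suc k) \<le> exp M / (Im z)\<^sup>2"
proof -
  have z: "norm z \<ge> \<bar>Im z\<bar>" by (rule abs_Im_le_cmod)
  have "(Im z)\<^sup>2 \<le> (norm z)\<^sup>2" using z by (metis abs_le_square_iff abs_norm_cancel)
  also have "\<dots> \<le> norm z ^ Suc k" using assms z by (intro power_increasing) auto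
  finally have *: "(Im z)\<^sup>2 \<le> norm z ^ Suc k" .
  have "norm (exp (z * of_real v) / z ^ Suc k) = exp (Re z * v) / norm z ^ Suc k"
    by (simp add: norm_divide norm_power norm_mult)
  also have "\<dots> \<le> exp M / (Im z)\<^sup>2"
    using assms * by (intro frac_le) auto
  finally show ?thesis .
qed

text \<open>For v \<le> 0 the exponential is bounded to the right, so the line can be moved to Re s
  = +\<infinity>, where the power makes the integral vanish.\<close>

lemma integral_exp_over_power_nonpos:
  assumes v: "v \<le> 0" and k: "k \<ge> 1"
  shows "(LINT t|lborel. exp (Complex 2 t * of_real v) / (Complex 2 t) ^ Suc k) = 0"
proof -
  define f where "f z = exp (z * of_real v) / z ^ Suc k" for z :: complex
  define I where "I c = (LINT t|lborel. f (Complex c t))" for c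
  have int: "integrable lborel (\<lambda>t. f (Complex c t))" if c: "c \<ge> 1" for c
    unfolding f_def
  proof (rule integrable_vertical_over_power[where M = 1])
    show "norm (exp (Complex c t * of_real v)) \<le> 1" for t
      using c v by (simp add: mult_nonneg_nonpos)
  qed (use c k in \<open>auto intro!: continuous_intros\<close>)
  have I: "I R = I 2" if R: "R > 2" for R
  proof -
    \<comment> \<open>The midpoint between the two lines is a dummy singularity: \<open>f\<close> is
      holomorphic in the right half plane and the residue there is 0.\<close>
    have "I R - I 2 = 2 * of_real pi * residue f (of_real ((2 + R) / 2))"
      unfolding I_def
    proof (rule vertical_line_shift[where S = "{z. Re z > 0}" and g = "\<lambda>T. 1 / T\<^sup>2"])
      show "((\<lambda>T::real. 1 / T\<^sup>2) \<longlongrightarrow> 0) at_top"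
        by (intro real_tendsto_divide_at_top[OF tendsto_const] filterlim_pow_at_top filterlim_ident) auto
      show "\<forall>\<^sub>F T in at_top. \<forall>x\<in>{2..R}. norm (f (Complex x T)) \<le> 1 / T\<^sup>2 \<and>
          norm (f (Complex x (- T))) \<le> 1 / T\<^sup>2"
        using eventually_ge_at_top[of 1]
      proof eventually_elim
        case (elim T)
        show ?case
        proof
          fix x :: real assume x: "x \<in> {2..R}"
          hence "x * v \<le> 0" using v by (simp add: mult_nonneg_nonpos)
          thus "norm (f (Complex x T)) \<le> 1 / T\<^sup>2 \<and> norm (f (Complex x (- T))) \<le> 1 / T\<^sup>2"
            unfolding f_def
            using norm_exp_over_power_le[of "Complex x T" v 0 k]
               norm_exp_over_power_le[of "Complex x (-T)" v 0 k] elim k by (simp del: power_Suc)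
        qed
      qed
      show "f holomorphic_on {z. Re z > 0} - {of_real ((2 + R) / 2)}"
        unfolding f_def by (intro holomorphic_intros) auto
    qed (use R in \<open>auto intro!: int open_halfspace_Re_gt convex_halfspace_Re_gt\<close>)
    also have "residue f (of_real ((2 + R) / 2)) = 0"
    proof (rule residue_holo[where s = "{z. Re z > 0}"])
      show "f holomorphic_on {z. Re z > 0}"
        unfolding f_def by (intro holomorphic_intros) auto
    qed (use R in \<open>auto intro!: open_halfspace_Re_gt\<close>)
    finally show ?thesis by simp
  qed
  have "(\<lambda>n. I (real n + 3)) \<longlonglongrightarrow> (LINT t|(lborel::real measure). 0)"
    unfolding I_def
  proof (rule integral_dominated_convergence[where w = "\<lambda>t. inverse (1 + t\<^sup>2)"])
    show "integrable lborel (\<lambda>t::real. inverse (1 + t\<^sup>2))" by (rule integrable_inverse_1_plus_sq)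
    show "(\<lambda>t. f (Complex (real n + 3) t)) \<in> borel_measurable lborel" for n
      using int[of "real n + 3"] by auto
    have fle: "norm (f (Complex c t)) \<le> norm (1 / (Complex c t) ^ Suc k)" if "c \<ge> 1" for c t
    proof -
      have "c * v \<le> 0" using that v by (intro mult_nonneg_nonpos) auto
      thus ?thesis by (simp add: f_def norm_divide norm_mult norm_power divide_right_mono)
    qed
    show "AE t in lborel. norm (f (Complex (real n + 3) t)) \<le> inverse (1 + t\<^sup>2)" for n
    proof (intro AE_I2)
      fix t :: real
      show "norm (f (Complex (real n + 3) t)) \<le> inverse (1 + t\<^sup>2)"
        using fle[of "real n + 3" t] norm_inverse_power_le[of "Complex (real n + 3) t" k] k by simp
    qed
    \<comment> \<open>For v = 0 the exponential has modulus 1 and gives no decay, so the limit is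
      taken from the power alone.\<close>
    show "AE t in lborel. (\<lambda>n. f (Complex (real n + 3) t)) \<longlonglongrightarrow> 0"
    proof (rule AE_I2, rule Lim_null_comparison)
      fix t :: real
      show "(\<lambda>n. 1 / (real n + 3)) \<longlonglongrightarrow> 0"
        unfolding add.commute[of _ 3]
        by (intro real_tendsto_divide_at_top[OF tendsto_const] filterlim_tendsto_add_at_top[OF tendsto_const]
            filterlim_real_sequentially)
      show "\<forall>\<^sub>F n in sequentially. norm (f (Complex (real n + 3) t)) \<le> 1 / (real n + 3)"
      proof (intro always_eventually allI)
        fix n
        let ?z = "Complex (real n + 3) t"
        have z: "norm ?z \<ge> real n + 3" using complex_Re_le_cmod[of ?z] by simp
        have "real n + 3 \<le> norm ?z ^ 1" using z by simp
        also have "\<dots> \<le> norm ?z ^ Suc k" using z by (intro power_increasing) auto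
        finally have "1 / norm ?z ^ Suc k \<le> 1 / (real n + 3)" by (intro divide_left_mono) auto
        with fle[of "real n + 3" t] show "norm (f ?z) \<le> 1 / (real n + 3)"
          by (simp add: norm_divide norm_power norm_mult)
      qed
    qed
  qed auto
  moreover have "I (real n + 3) = I 2" for n by (rule I) simp
  ultimately have "(\<lambda>n::nat. I 2) \<longlonglongrightarrow> 0" by simp
  thus ?thesis by (simp add: LIMSEQ_const_iff I_def f_def)
qed

lemma higher_deriv_exp_mult: "(deriv ^^ n) (\<lambda>z. exp (z * c)) = (\<lambda>z::complex. c ^ n * exp (z * c))"
proof (induction n)
  case (Suc n)
  have "deriv (\<lambda>z. c ^ n * exp (z * c)) z = c ^ Suc n * exp (z * c)" for z
    by (rule DERIV_imp_deriv) (auto intro!: derivative_eq_intros)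
  with Suc show ?case by auto
qed auto

text \<open>For v > 0 the line moves left across the pole at 0, whose residue is the Taylor
  coefficient v^k/k! of the exponential. The integral over Re s = -2 is 0 by reflection to the case
  already treated.\<close>

lemma integral_exp_over_power:
  assumes k: "k \<ge> 1"
  shows "(LINT t|lborel. exp (Complex 2 t * of_real v) / (Complex 2 t) ^ Suc k) =
    of_real (2 * pi * trunc_pow k v)"
proof (cases "v \<le> 0")
  case True
  thus ?thesis using integral_exp_over_power_nonpos[OF True k] k by (auto simp: trunc_pow_def)
next
  case False
  define f where "f z = exp (z * of_real v) / z ^ Suc k" for z :: complex
  have int: "integrable lborel (\<lambda>t. f (Complex c t))" if "\<bar>c\<bar> = 2" for c
    unfolding f_def using that k
    by (intro integrable_vertical_over_power[where M = "exp (c * v)"]) (auto intro!: continuous_intros)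
  \<comment> \<open>Replacing t by -t turns s = -2 + it into the negative of a point on Re s = 2; up
    to the sign (-1)^(k+1) this is the integral for -v < 0.\<close>
  have "(LINT t|lborel. f (Complex (-2) t)) = (LINT t|lborel. f (Complex (-2) (-t)))"
    using lborel_integral_real_affine[of "-1" "\<lambda>t. f (Complex (-2) t)" 0] by simp
  also have "\<dots> = (LINT t|lborel. (-1) ^ Suc k * (exp (Complex 2 t * of_real (-v)) / (Complex 2 t) ^ Suc k))"
  proof (intro Bochner_Integration.integral_cong refl)
    fix t
    have "Complex (-2) (-t) = - Complex 2 t" by (simp add: complex_eq_iff)
    thus "f (Complex (-2) (-t)) = (-1) ^ Suc k * (exp (Complex 2 t * of_real (-v)) / (Complex 2 t) ^ Suc k)"
      unfolding f_def by (cases "even (Suc k)") (simp_all del: power_Suc even_Suc)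
  qed
  also have "\<dots> = 0"
    using integral_exp_over_power_nonpos[of "-v" k] False k by (simp only: integral_mult_right_zero) simp
  finally have neg: "(LINT t|lborel. f (Complex (-2) t)) = 0" .
  have "(LINT t|lborel. f (Complex 2 t)) - (LINT t|lborel. f (Complex (-2) t)) = 2 * of_real pi * residue f 0"
  proof (rule vertical_line_shift[where S = UNIV and g = "\<lambda>T. exp (2 * v) / T\<^sup>2"])
    show "((\<lambda>T::real. exp (2 * v) / T\<^sup>2) \<longlongrightarrow> 0) at_top"
      by (intro real_tendsto_divide_at_top[OF tendsto_const] filterlim_pow_at_top filterlim_ident) auto
    show "\<forall>\<^sub>F T in at_top. \<forall>x\<in>{-2..2}. norm (f (Complex x T)) \<le> exp (2 * v) / T\<^sup>2 \<and>
        norm (f (Complex x (- T))) \<le> exp (2 * v) / T\<^sup>2"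
      using eventually_ge_at_top[of 1]
    proof eventually_elim
      case (elim T)
      show ?case
      proof
        fix x :: real assume x: "x \<in> {-2..2}"
        hence "x * v \<le> 2 * v" using False by simp
        thus "norm (f (Complex x T)) \<le> exp (2 * v) / T\<^sup>2 \<and> norm (f (Complex x (- T))) \<le> exp (2 * v) / T\<^sup>2"
          unfolding f_def
          using norm_exp_over_power_le[of "Complex x T" v "2 * v" k]
             norm_exp_over_power_le[of "Complex x (-T)" v "2 * v" k] elim k by (simp del: power_Suc)
      qed
    qed
    show "f holomorphic_on UNIV - {0}"
      unfolding f_def by (intro holomorphic_intros) auto
  qed (auto intro!: int)
  also have "residue f 0 = of_real (v ^ k / fact k)"
    unfolding f_def by (subst residue_holomorphic_over_power'[of UNIV]) (auto simp: higher_deriv_exp_mult intro!: holomorphic_intros)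
  finally show ?thesis using False neg by (simp add: f_def trunc_pow_def)
qed

text \<open>Multiplication by exp(sh) translates v by h, so each factor exp(sh) - 1 is one forward
  difference in v.\<close>

lemma integral_exp_diff_over_power:
  assumes k: "k \<ge> 1"
  shows "(LINT t|lborel. exp (Complex 2 t * of_real v) * (exp (Complex 2 t * of_real h) - 1) ^ j / (Complex 2 t) ^ Suc k) =
    of_real (2 * pi * fdiff h j (trunc_pow k) v)"
proof (induction j arbitrary: v)
  case 0
  show ?case using integral_exp_over_power[OF k] by simp
next
  case (Suc j)
  define f where "f v t = exp (Complex 2 t * of_real v) * (exp (Complex 2 t * of_real h) - 1) ^ j / (Complex 2 t) ^ Suc k" for v t
  have int: "integrable lborel (f v)" for v
    unfolding f_def
  proof (rule integrable_vertical_over_power[where M = "exp (2 * v) * (exp (2 * h) + 1) ^ j"])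
    fix t
    have "norm (exp (Complex 2 t * of_real h) - 1) \<le> exp (2 * h) + 1"
      using norm_triangle_ineq4[of "exp (Complex 2 t * of_real h)" 1] by simp
    thus "norm (exp (Complex 2 t * of_real v) * (exp (Complex 2 t * of_real h) - 1) ^ j) \<le> exp (2 * v) * (exp (2 * h) + 1) ^ j"
      by (simp add: norm_mult norm_power power_mono)
  qed (use k in \<open>auto intro!: continuous_intros\<close>)
  have "(LINT t|lborel. exp (Complex 2 t * of_real v) * (exp (Complex 2 t * of_real h) - 1) ^ Suc j / (Complex 2 t) ^ Suc k)
     = (LINT t|lborel. f (v + h) t - f v t)"
    by (intro Bochner_Integration.integral_cong refl)
      (simp add: f_def ring_distribs exp_add power_Suc2[of _ j] mult_ac flip: diff_divide_distrib del: power_Suc)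
  also have "\<dots> = (LINT t|lborel. f (v + h) t) - (LINT t|lborel. f v t)"
    using int by (intro Bochner_Integration.integral_diff)
  also have "\<dots> = of_real (2 * pi * fdiff h (Suc j) (trunc_pow k) v)"
    unfolding f_def Suc by (simp add: right_diff_distrib)
  finally show ?case .
qed

section \<open>The zeta function as an alternating series\<close>

text \<open>Differentiation sends x^(-s) to -s x^(-s-1), so every difference gains about |s|/x. The
  induction must vary s because the step uses the hypothesis at s + 1; the summand j in the base
  absorbs |s + 1| \<le> |s| + 1 at each stage.\<close>

lemma norm_fdiff_powr_le:
  fixes s :: complex
  assumes "Re s > 0" "x > 0"
  shows "norm (fdiff 1 j (\<lambda>x. of_real x powr (- s)) x) \<le> (norm s + real j) ^ j * x powr (- Re s - real j)"
  using assms
proof (induction j arbitrary: s x)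
  case 0
  thus ?case by (simp add: norm_powr_real_powr)
next
  case (Suc j)
  define F where "F s = fdiff 1 j (\<lambda>x. of_real x powr (- s))" for s :: complex
  have D: "(F s has_vector_derivative - s * F (s + 1) x) (at x)" if "x > 0" for x s
    unfolding F_def using that
  proof (induction j arbitrary: x)
    case 0
    have "((\<lambda>z. z powr (- s)) has_field_derivative - s * of_real x powr (- s - 1)) (at (of_real x))"
      using 0 by (auto intro!: derivative_eq_intros simp: complex_nonpos_Reals_iff)
    from has_vector_derivative_real_field[OF this] show ?case by simp
  next
    case (Suc j)
    have "((\<lambda>x. fdiff 1 j (\<lambda>x. of_real x powr (- s)) (x + 1)) has_vector_derivative
        - s * fdiff 1 j (\<lambda>x. of_real x powr (- (s + 1))) (x + 1)) (at x)"
    proof -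
      have "(((\<lambda>x. fdiff 1 j (\<lambda>x. of_real x powr (- s)) x) \<circ> (\<lambda>x. x + 1)) has_vector_derivative
        1 *\<^sub>R (- s * fdiff 1 j (\<lambda>x. of_real x powr (- (s + 1))) (x + 1))) (at x)"
        using Suc by (intro vector_diff_chain_at) (auto intro!: derivative_eq_intros)
      thus ?thesis by (simp add: o_def)
    qed
    from has_vector_derivative_diff[OF this Suc.IH[OF Suc.prems]] show ?case
      by (simp add: algebra_simps)
  qed
  define M where "M = norm s * ((norm s + 1 + real j) ^ j * x powr (- Re s - 1 - real j))"
  have "norm (F s (x + 1) - F s x) \<le> M * norm (x + 1 - x)"
  proof (rule differentiable_bound[where S = "{x..x + 1}" and f' = "\<lambda>y h. h *\<^sub>R (- s * F (s + 1) y)"])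
    fix y assume y: "y \<in> {x..x + 1}"
    hence "(F s has_vector_derivative - s * F (s + 1) y) (at y)" using Suc.prems by (intro D) auto
    thus "(F s has_derivative (\<lambda>h. h *\<^sub>R (- s * F (s + 1) y))) (at y within {x..x + 1})"
      by (simp add: has_vector_derivative_def has_derivative_at_withinI)
    have "norm (F (s + 1) y) \<le> (norm (s + 1) + real j) ^ j * y powr (- Re s - 1 - real j)"
      using Suc.IH[of "s + 1" y] Suc.prems y by (simp add: F_def)
    also have "\<dots> \<le> (norm s + 1 + real j) ^ j * x powr (- Re s - 1 - real j)"
      using Suc.prems y norm_triangle_ineq[of s 1] by (intro mult_mono power_mono powr_mono2') auto
    finally have "norm (- s * F (s + 1) y) \<le> M"
      unfolding M_def by (simp add: norm_mult mult_left_mono)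
    thus "onorm (\<lambda>h. h *\<^sub>R (- s * F (s + 1) y)) \<le> M"
      by (intro onorm_bound)
        (auto simp: mult.commute[of M] intro: mult_left_mono order_trans[OF norm_ge_zero])
  qed auto
  also have "\<dots> \<le> (norm s + real (Suc j)) ^ Suc j * x powr (- Re s - real (Suc j))"
    unfolding M_def by (auto simp: mult_ac add_ac diff_diff_eq intro!: mult_right_mono mult_mono)
  finally show ?case by (simp add: F_def)
qed

text \<open>Euler's transformation: adding neighbouring terms of an alternating sum telescopes, and
  what remains is half an alternating sum of first differences. The hypothesis bounds the boundary
  terms of the K rounds.\<close>

lemma norm_alternating_sum_le:
  fixes f :: "real \<Rightarrow> complex"
  assumes "N \<le> M"
    and "\<And>j n. j < K \<Longrightarrow> n \<ge> N \<Longrightarrow> norm (fdiff 1 j f (real n)) \<le> 1"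
  shows "norm (\<Sum>n=N..<M. (-1) ^ n * f (real n)) \<le> 2 * real K + (\<Sum>n=N..<M. norm (fdiff 1 K f (real n)))"
proof -
  define T where "T j = (\<Sum>n=N..<M. (-1) ^ n * fdiff 1 j f (real n))" for j
  have step: "2 * T j = (-1) ^ N * fdiff 1 j f (real N) - (-1) ^ M * fdiff 1 j f (real M) - T (Suc j)" for j
  proof -
    define g where "g n = (-1) ^ n * fdiff 1 j f (real n)" for n
    have "T (Suc j) = (\<Sum>n=N..<M. - (g (Suc n)) - g n)"
      unfolding T_def g_def by (intro sum.cong) (auto simp: algebra_simps)
    also have "\<dots> = (\<Sum>n=N..<M. - (g (Suc n) - g n) - 2 * g n)"
      by (intro sum.cong) auto
    also have "\<dots> = - (\<Sum>n=N..<M. g (Suc n) - g n) - 2 * (\<Sum>n=N..<M. g n)"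
      by (simp only: sum_subtractf sum_negf sum_distrib_left)
    also have "\<dots> = - (g M - g N) - 2 * T j"
      unfolding sum_Suc_diff'[OF assms(1)] by (simp add: T_def g_def)
    finally show ?thesis by (simp add: g_def)
  qed
  have "norm (T 0) \<le> 2 * real j + norm (T j)" if "j \<le> K" for j
    using that
  proof (induction j)
    case (Suc j)
    \<comment> \<open>This yields |T_j| \<le> 1 + |T_(j+1)|/2; the halving is given away for the
      simpler 2 + |T_(j+1)|.\<close>
    have "2 * norm (T j) = norm (2 * T j)" by (simp add: norm_mult)
    also have "\<dots> \<le> norm (fdiff 1 j f (real N)) + norm (fdiff 1 j f (real M)) + norm (T (Suc j))"
      unfolding step
      by (rule order_trans[OF norm_triangle_ineq4]; (rule add_mono order_trans[OF norm_triangle_ineq4] order_refl)+; simp add: norm_mult norm_power)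
    also have "\<dots> \<le> 1 + 1 + norm (T (Suc j))"
      using Suc.prems assms by (intro add_mono) auto
    finally show ?case using Suc norm_ge_zero[of "T (Suc j)"] by (simp; linarith)
  qed auto
  from this[of K] have "norm (T 0) \<le> 2 * real K + norm (T K)" by simp
  also have "norm (T K) \<le> (\<Sum>n=N..<M. norm (fdiff 1 K f (real n)))"
    unfolding T_def by (rule order_trans[OF norm_sum]) (simp add: norm_mult norm_power)
  finally show ?thesis by (simp add: T_def)
qed

text \<open>The two conditions on N have separate tasks. The first makes |s| + j \<le> n, so the
  differences of order below K are at most n^(-1/2). The second saves one further factor n at order
  K, leaving the summable n^(-3/2).\<close>

lemma norm_alternating_zeta_tail_le:
  fixes s :: complex
  assumes s: "Re s = 1 / 2" and N: "N \<le> M" "K \<ge> 1" "norm s + real K \<le> real N" "(norm s + real K) ^ K \<le> real N ^ (K - 1)"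
  shows "norm (\<Sum>n=N..<M. (-1) ^ n * of_nat n powr (- s)) \<le> 2 * real K + (\<Sum>n. real n powr (- (3 / 2)))"
proof -
  let ?f = "\<lambda>x::real. (of_real x :: complex) powr (- s)"
  have N0: "real N > 0" using N norm_ge_zero[of s] by linarith
  have sm: "summable (\<lambda>n. real n powr (- (3 / 2)))" by (subst summable_real_powr_iff) auto
  have "norm (\<Sum>n=N..<M. (-1) ^ n * ?f (real n)) \<le> 2 * real K + (\<Sum>n=N..<M. norm (fdiff 1 K ?f (real n)))"
  proof (rule norm_alternating_sum_le[OF N(1)])
    fix j n assume j: "j < K" "n \<ge> N"
    have n: "real n > 0" "real n \<ge> 1" using N0 j by auto
    have "norm (fdiff 1 j ?f (real n)) \<le> (norm s + real j) ^ j * real n powr (- (1 / 2) - real j)"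
      using norm_fdiff_powr_le[of s "real n" j] n s by simp
    also have "\<dots> \<le> real n ^ j * real n powr (- (1 / 2) - real j)"
      using N j by (intro mult_right_mono power_mono) auto
    also have "\<dots> = real n powr (- (1 / 2))"
      using n by (simp flip: powr_realpow powr_add)
    also have "\<dots> \<le> real n powr 0" using n by (intro powr_mono) auto
    finally show "norm (fdiff 1 j ?f (real n)) \<le> 1" using n by simp
  qed
  also have "(\<Sum>n=N..<M. norm (fdiff 1 K ?f (real n))) \<le> (\<Sum>n=N..<M. real n powr (- (3 / 2)))"
  proof (rule sum_mono)
    fix n assume "n \<in> {N..<M}"
    hence n: "real n \<ge> real N" "real n > 0" using N0 by auto
    have "norm (fdiff 1 K ?f (real n)) \<le> (norm s + real K) ^ K * real n powr (- (1 / 2) - real K)"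
      using norm_fdiff_powr_le[of s "real n" K] n s by simp
    also have "\<dots> \<le> real n ^ (K - 1) * real n powr (- (1 / 2) - real K)"
      using N n by (intro mult_right_mono order_trans[OF N(4)] power_mono) auto
    also have "\<dots> = real n powr (- (3 / 2))"
      using n N(2) by (simp add: of_nat_diff flip: powr_realpow powr_add)
    finally show "norm (fdiff 1 K ?f (real n)) \<le> real n powr (- (3 / 2))" .
  qed
  also have "\<dots> \<le> (\<Sum>n. real n powr (- (3 / 2)))"
    by (intro sum_le_suminf sm) auto
  finally show ?thesis by simp
qed

lemma zeta_partial_sums:
  assumes s: "Re s > 0" "s \<noteq> 1"
  shows "(\<lambda>N. (\<Sum>n=1..N. of_nat n powr (- s)) - of_nat (Suc N) powr (1 - s) / (1 - s)) \<longlonglongrightarrow> riemann_zeta s"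
proof -
  have "summable (\<lambda>n. norm s * real n powr (- Re s - 1))"
    using s by (intro summable_mult) (subst summable_real_powr_iff, auto)
  hence "summable (\<lambda>n. norm s * real (Suc n) powr (- Re s - 1))"
    by (subst summable_Suc_iff)
  hence "summable (\<lambda>n. zeta_summand (Suc n) s)"
    by (rule summable_comparison_test'[where N = 0]) (intro norm_zeta_summand_le s, simp)
  hence "(\<lambda>N. 1 / (s - 1) + (\<Sum>n<N. zeta_summand (Suc n) s)) \<longlonglongrightarrow> riemann_zeta s"
    unfolding riemann_zeta_def by (intro tendsto_intros summable_LIMSEQ)
  moreover have "1 / (s - 1) + (\<Sum>n<N. zeta_summand (Suc n) s) =
      (\<Sum>n=1..N. of_nat n powr (- s)) - of_nat (Suc N) powr (1 - s) / (1 - s)" for N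
  proof (induction N)
    case 0
    show ?case using s by (simp add: divide_simps)
  next
    case (Suc N)
    thus ?case by (simp add: zeta_summand_def diff_divide_distrib algebra_simps)
  qed
  ultimately show ?thesis by simp
qed

text \<open>With (-1)^n the series starts at -1, hence the factor 2^(1-s) - 1 rather than its
  negative. Twice the even-indexed terms minus all terms gives the alternating sum, which is why the
  partial sums have even length 2N.\<close>

lemma alternating_zeta:
  assumes s: "Re s > 0" "s \<noteq> 1"
  shows "(\<lambda>N. \<Sum>n=1..<Suc (2 * N). (-1) ^ n * of_nat n powr (- s)) \<longlonglongrightarrow> (2 powr (1 - s) - 1) * riemann_zeta s"
proof -
  define Z where "Z N = (\<Sum>n=1..N. of_nat n powr (- s)) - of_nat (Suc N) powr (1 - s) / (1 - s)" for N
  \<comment> \<open>The boundary terms of \<open>Z N\<close> and \<open>Z (2 * N)\<close> do not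
    cancel exactly: one has (2N+2)^(1-s), the other (2N+1)^(1-s). Their difference, divided by 1 -
    s, is \<open>d N\<close>, written through \<open>zeta_summand\<close> so that its known bound
    shows d \<rightarrow> 0.\<close>
  define d where "d N = of_nat (2 * N + 1) powr (- s) - zeta_summand (2 * N + 1) s" for N
  have Z: "Z \<longlonglongrightarrow> riemann_zeta s" unfolding Z_def by (rule zeta_partial_sums[OF s])
  have Z2: "(\<lambda>N. Z (2 * N)) \<longlonglongrightarrow> riemann_zeta s"
    using LIMSEQ_subseq_LIMSEQ[OF Z, of "\<lambda>N. 2 * N"] by (simp add: strict_mono_def o_def)
  have "d \<longlonglongrightarrow> 0"
  proof (rule Lim_null_comparison)
    have "((\<lambda>N::nat. real (2 * N + 1) powr (- Re s)) \<longlonglongrightarrow> 0)" using s by real_asymp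
    moreover have "((\<lambda>N::nat. norm s * real (2 * N + 1) powr (- Re s - 1)) \<longlonglongrightarrow> 0)" using s by real_asymp
    ultimately show "(\<lambda>N. real (2 * N + 1) powr (- Re s) + norm s * real (2 * N + 1) powr (- Re s - 1)) \<longlonglongrightarrow> 0"
      using tendsto_add by fastforce
    show "\<forall>\<^sub>F N in sequentially. norm (d N) \<le> real (2 * N + 1) powr (- Re s) + norm s * real (2 * N + 1) powr (- Re s - 1)"
    proof (intro always_eventually allI)
      fix N
      have "norm (d N) \<le> norm ((of_nat (2 * N + 1) :: complex) powr (- s)) + norm (zeta_summand (2 * N + 1) s)"
        unfolding d_def by (rule norm_triangle_ineq4)
      also have "norm ((of_nat (2 * N + 1) :: complex) powr (- s)) = real (2 * N + 1) powr (- Re s)"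
        using norm_Suc_powr[of "2 * N" "- s"] by simp
      also have "norm (zeta_summand (2 * N + 1) s) \<le> norm s * real (2 * N + 1) powr (- Re s - 1)"
        by (rule norm_zeta_summand_le[OF s]) simp
      finally show "norm (d N) \<le> real (2 * N + 1) powr (- Re s) + norm s * real (2 * N + 1) powr (- Re s - 1)"
        by simp
    qed
  qed
  hence "(\<lambda>N. 2 powr (1 - s) * Z N - Z (2 * N) + d N) \<longlonglongrightarrow> 2 powr (1 - s) * riemann_zeta s - riemann_zeta s + 0"
    by (intro tendsto_intros Z Z2)
  moreover have "2 powr (1 - s) * Z N - Z (2 * N) + d N = (\<Sum>n=1..<Suc (2 * N). (-1) ^ n * of_nat n powr (- s))" for N
  proof -
    have mulp: "(2::complex) powr c * of_nat n powr c = of_nat (2 * n) powr c" for c n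
      by (subst powr_times_real[symmetric]) auto
    have even: "2 powr (1 - s) * (\<Sum>n=1..N. of_nat n powr (- s)) - (\<Sum>n=1..2 * N. of_nat n powr (- s)) =
        (\<Sum>n=1..<Suc (2 * N). (-1) ^ n * of_nat n powr (- s))"
    proof (induction N)
      case (Suc N)
      have two: "2 powr (1 - s) * (of_nat (Suc N) :: complex) powr (- s) = 2 * of_nat (2 * Suc N) powr (- s)"
        using mulp[of "- s" "Suc N"] powr_add[of 2 1 "- s"] by (simp add: mult.assoc del: of_nat_Suc)
      show ?case using Suc two by (simp add: algebra_simps)
    qed simp
    have p: "2 powr (1 - s) * (of_nat (Suc N) :: complex) powr (1 - s) = of_nat (2 * Suc N) powr (1 - s)"
      by (rule mulp)
    have "d N = (of_nat (2 * Suc N) powr (1 - s) - of_nat (Suc (2 * N)) powr (1 - s)) / (1 - s)"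
      by (simp add: d_def zeta_summand_def)
    thus ?thesis unfolding even[symmetric] Z_def using p
      by (simp add: right_diff_distrib diff_divide_distrib)
  qed
  ultimately show ?thesis by (simp add: algebra_simps)
qed

lemma norm_zeta_critical_line_le:
  fixes s :: complex
  assumes s: "Re s = 1 / 2" and N: "K \<ge> 1" "norm s + real K \<le> real N" "(norm s + real K) ^ K \<le> real N ^ (K - 1)"
  shows "norm (riemann_zeta s) \<le> 3 * (norm (\<Sum>n=1..<N. (-1) ^ n * of_nat n powr (- s)) + (2 * real K + (\<Sum>n. real n powr (- (3 / 2)))))"
proof -
  let ?c = "2 * real K + (\<Sum>n. real n powr (- (3 / 2)))"
  let ?S = "\<lambda>A. \<Sum>n\<in>A. (-1) ^ n * (of_nat n :: complex) powr (- s)"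
  have s1: "s \<noteq> 1" using s by auto
  have N1: "N \<ge> 1" using N(1,2) norm_ge_zero[of s] by linarith
  have "norm ((2 powr (1 - s) - 1) * riemann_zeta s) \<le> norm (?S {1..<N}) + ?c"
  proof (rule tendsto_upperbound)
    show "(\<lambda>M. norm (?S {1..<Suc (2 * M)})) \<longlonglongrightarrow> norm ((2 powr (1 - s) - 1) * riemann_zeta s)"
      using s s1 by (intro tendsto_norm alternating_zeta) auto
    show "\<forall>\<^sub>F M in sequentially. norm (?S {1..<Suc (2 * M)}) \<le> norm (?S {1..<N}) + ?c"
      using eventually_ge_at_top[of N]
    proof eventually_elim
      case (elim M)
      have "?S {1..<Suc (2 * M)} = ?S {1..<N} + ?S {N..<Suc (2 * M)}"
        using elim N1 by (intro sum.atLeastLessThan_concat[symmetric]) auto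
      thus ?case using norm_alternating_zeta_tail_le[OF s, of N "Suc (2 * M)" K] elim N
        norm_triangle_ineq[of "?S {1..<N}" "?S {N..<Suc (2 * M)}"] by simp
    qed
  qed auto
  \<comment> \<open>On the critical line |2^(1-s)| = sqrt 2, so the factor stays away from 0; this
    is the source of the 3 in the statement.\<close>
  moreover have "norm (2 powr (1 - s) - 1) \<ge> 1 / 3"
  proof -
    have "norm ((2::complex) powr (1 - s)) = sqrt 2"
      using norm_powr_real_powr[of 2 "1 - s"] s by (simp add: powr_half_sqrt)
    moreover have "sqrt 2 \<ge> 4 / 3" by (rule real_le_rsqrt) (simp add: power2_eq_square)
    ultimately show ?thesis using norm_triangle_ineq2[of "2 powr (1 - s)" 1] by simp
  qed
  hence "1 / 3 * norm (riemann_zeta s) \<le> norm (2 powr (1 - s) - 1) * norm (riemann_zeta s)"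
    by (intro mult_right_mono) auto
  ultimately show ?thesis by (simp add: norm_mult)
qed

section \<open>The mean square of the zeta function on the critical line\<close>

lemma integral_cos_le:
  fixes X l :: real
  assumes "X > 0"
  shows "\<bar>integral {X..2*X} (\<lambda>t. cos (t * l))\<bar> \<le> (if l = 0 then X else 2 / \<bar>l\<bar>)"
proof (cases "l = 0")
  case False
  have "((\<lambda>t. cos (t * l)) has_integral sin (2 * X * l) / l - sin (X * l) / l) {X..2*X}"
    using assms False
    by (intro fundamental_theorem_of_calculus)
       (auto intro!: derivative_eq_intros simp flip: has_real_derivative_iff_has_vector_derivative)
  hence "integral {X..2*X} (\<lambda>t. cos (t * l)) = (sin (2 * X * l) - sin (X * l)) / l"
    by (simp add: integral_unique diff_divide_distrib)
  moreover have "\<bar>sin (2 * X * l) - sin (X * l)\<bar> \<le> 2"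
    using abs_sin_le_one[of "2 * X * l"] abs_sin_le_one[of "X * l"] by linarith
  ultimately show ?thesis using False by (simp add: abs_divide divide_right_mono)
qed (use assms in simp)

lemma norm_sum_cis_squared:
  fixes u L :: "nat \<Rightarrow> real"
  shows "(norm (\<Sum>n\<in>A. of_real (u n) * cis (- (t * L n))))\<^sup>2 =
    (\<Sum>m\<in>A. \<Sum>n\<in>A. u m * u n * cos (t * (L m - L n)))"
proof -
  have "(norm (\<Sum>n\<in>A. of_real (u n) * cis (- (t * L n))))\<^sup>2 =
      (\<Sum>n\<in>A. u n * cos (t * L n)) * (\<Sum>n\<in>A. u n * cos (t * L n)) +
      (\<Sum>n\<in>A. u n * sin (t * L n)) * (\<Sum>n\<in>A. u n * sin (t * L n))"
    unfolding cmod_power2 by (simp add: power2_eq_square sum_negf)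
  also have "\<dots> = (\<Sum>m\<in>A. \<Sum>n\<in>A. u m * u n * cos (t * (L m - L n)))"
    unfolding sum_product sum.distrib[symmetric]
    by (intro sum.cong refl) (simp add: right_diff_distrib cos_diff algebra_simps)
  finally show ?thesis .
qed

lemma integral_norm_sum_cis_squared_le:
  fixes u L :: "nat \<Rightarrow> real"
  assumes "X > 0" "finite A"
  shows "integral {X..2*X} (\<lambda>t. (norm (\<Sum>n\<in>A. of_real (u n) * cis (- (t * L n))))\<^sup>2) \<le>
    (\<Sum>m\<in>A. \<Sum>n\<in>A. \<bar>u m * u n\<bar> * (if L m = L n then X else 2 / \<bar>L m - L n\<bar>))"
proof -
  have "((\<lambda>t. \<Sum>m\<in>A. \<Sum>n\<in>A. u m * u n * cos (t * (L m - L n))) has_integral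
      (\<Sum>m\<in>A. \<Sum>n\<in>A. u m * u n * integral {X..2*X} (\<lambda>t. cos (t * (L m - L n))))) {X..2*X}"
    using assms by (intro has_integral_sum has_integral_mult_right integrable_integral
       integrable_continuous_real continuous_intros) auto
  hence "integral {X..2*X} (\<lambda>t. (norm (\<Sum>n\<in>A. of_real (u n) * cis (- (t * L n))))\<^sup>2) =
      (\<Sum>m\<in>A. \<Sum>n\<in>A. u m * u n * integral {X..2*X} (\<lambda>t. cos (t * (L m - L n))))"
    unfolding norm_sum_cis_squared by (rule integral_unique)
  also have "\<dots> \<le> (\<Sum>m\<in>A. \<Sum>n\<in>A. \<bar>u m * u n\<bar> * (if L m = L n then X else 2 / \<bar>L m - L n\<bar>))"
  proof (intro sum_mono)
    fix m n
    have "u m * u n * integral {X..2*X} (\<lambda>t. cos (t * (L m - L n))) \<le>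
        \<bar>u m * u n\<bar> * \<bar>integral {X..2*X} (\<lambda>t. cos (t * (L m - L n)))\<bar>"
      by (metis abs_ge_self abs_mult)
    also have "\<dots> \<le> \<bar>u m * u n\<bar> * (if L m = L n then X else 2 / \<bar>L m - L n\<bar>)"
      using integral_cos_le[OF assms(1), of "L m - L n"] by (intro mult_left_mono) auto
    finally show "u m * u n * integral {X..2*X} (\<lambda>t. cos (t * (L m - L n))) \<le>
        \<bar>u m * u n\<bar> * (if L m = L n then X else 2 / \<bar>L m - L n\<bar>)" .
  qed
  finally show ?thesis .
qed

text \<open>Uses AM-GM in the form \<open>2 \<surd>(n/m) \<le> 1 + n/m\<close>.\<close>

lemma off_diagonal_le_aux:
  fixes m n :: nat
  assumes "1 \<le> m" "m < n"
  shows "1 / (sqrt (real m) * sqrt (real n)) * (2 / \<bar>ln (real m) - ln (real n)\<bar>) \<le> 2 / real (n - m) + 1 / real m"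
proof -
  define x y where "x = real m" and "y = real n"
  have xy: "0 < x" "x < y" using assms by (auto simp: x_def y_def)
  have "ln (x / y) \<le> x / y - 1" using xy by (intro ln_le_minus_one) auto
  hence l: "(y - x) / y \<le> ln y - ln x" using xy by (simp add: ln_div field_simps)
  have pos: "(y - x) / y > 0" using xy by simp
  have lpos: "ln y - ln x > 0" using l pos by linarith
  have "2 / \<bar>ln x - ln y\<bar> = 2 / (ln y - ln x)" using l pos by simp
  also have "\<dots> \<le> 2 / ((y - x) / y)" using l pos lpos by (intro divide_left_mono mult_pos_pos) auto
  finally have "1 / (sqrt x * sqrt y) * (2 / \<bar>ln x - ln y\<bar>) \<le> 1 / (sqrt x * sqrt y) * (2 * y / (y - x))"
    using xy by (intro mult_left_mono) auto
  also have "\<dots> = 2 * (sqrt x * sqrt y) / (x * (y - x))"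
  proof -
    have "1 / (sqrt x * sqrt y) = sqrt x * sqrt y / (x * y)"
      using xy by (simp add: field_simps) 
    thus ?thesis using xy by simp
  qed
  also have "\<dots> \<le> (x + y) / (x * (y - x))"
    using arith_geo_mean_sqrt[of x y] xy by (intro divide_right_mono) (auto simp: real_sqrt_mult)
  also have "\<dots> = 2 / (y - x) + 1 / x" using xy by (simp add: field_simps)
  finally show ?thesis using assms by (simp add: x_def y_def of_nat_diff)
qed

text \<open>Both 1/m and 1/n are kept on the right so that the bound is symmetric and the double sum
  need not be split by the order of m and n.\<close>

lemma off_diagonal_le:
  fixes m n :: nat
  assumes "1 \<le> m" "1 \<le> n" "m \<noteq> n"
  shows "1 / (sqrt (real m) * sqrt (real n)) * (2 / \<bar>ln (real m) - ln (real n)\<bar>) \<le>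
    2 / \<bar>real m - real n\<bar> + 1 / real m + 1 / real n"
proof (cases "m < n")
  case True
  hence "2 / \<bar>real m - real n\<bar> = 2 / real (n - m)" by (simp add: of_nat_diff)
  thus ?thesis using True off_diagonal_le_aux[of m n] assms zero_le_divide_1_iff[of "real n"] by linarith
next
  case False
  hence "2 / \<bar>real m - real n\<bar> = 2 / real (m - n)" by (simp add: of_nat_diff)
  moreover have "1 / (sqrt (real n) * sqrt (real m)) * (2 / \<bar>ln (real n) - ln (real m)\<bar>) =
      1 / (sqrt (real m) * sqrt (real n)) * (2 / \<bar>ln (real m) - ln (real n)\<bar>)"
    by (simp only: mult.commute[of "sqrt (real n)"] abs_minus_commute)
  ultimately show ?thesis using False off_diagonal_le_aux[of n m] assms zero_le_divide_1_iff[of "real m"] by linarith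
qed

text \<open>The distances to the left and to the right of n each run through an initial segment of
  the harmonic sum.\<close>

lemma sum_inverse_distance_le:
  assumes "n \<in> {1..N}"
  shows "(\<Sum>m\<in>{1..N} - {n}. 1 / \<bar>real m - real n\<bar>) \<le> 2 * harm N"
proof -
  have split: "{1..N} - {n} = {1..<n} \<union> {n<..N}" using assms by auto
  have "(\<Sum>m\<in>{1..N} - {n}. 1 / \<bar>real m - real n\<bar>) =
      (\<Sum>m=1..<n. 1 / \<bar>real m - real n\<bar>) + (\<Sum>m\<in>{n<..N}. 1 / \<bar>real m - real n\<bar>)"
    unfolding split by (rule sum.union_disjoint) auto
  also have "(\<Sum>m=1..<n. 1 / \<bar>real m - real n\<bar>) = (\<Sum>k=1..<n. 1 / real k)"
    by (rule sum.reindex_bij_witness[of _ "\<lambda>k. n - k" "\<lambda>m. n - m"]) (auto simp: of_nat_diff)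
  also have "\<dots> \<le> harm N"
    unfolding harm_def using assms by (auto simp: inverse_eq_divide intro!: sum_mono2)
  also have "(\<Sum>m\<in>{n<..N}. 1 / \<bar>real m - real n\<bar>) = (\<Sum>k=1..N-n. 1 / real k)"
    by (rule sum.reindex_bij_witness[of _ "\<lambda>k. n + k" "\<lambda>m. m - n"]) (auto simp: of_nat_diff)
  also have "\<dots> \<le> harm N"
    unfolding harm_def using assms by (auto simp: inverse_eq_divide intro!: sum_mono2)
  finally show ?thesis by simp
qed

text \<open>The diagonal contributes X times the harmonic sum. Of the 6N, the terms 2/|m - n| give
  4N, and the terms 1/m and 1/n give N each. Termwise integration loses a logarithm, which is
  harmless next to X^\<epsilon>.\<close>

lemma integral_norm_dirichlet_polynomial_squared_le:
  fixes u :: "nat \<Rightarrow> real"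
  assumes X: "X > 0" and u: "\<And>n. \<bar>u n\<bar> \<le> 1"
  shows "integral {X..2*X} (\<lambda>t. (norm (\<Sum>n=1..N. of_real (u n) * of_nat n powr (- (1/2 + \<i> * of_real t))))\<^sup>2)
    \<le> (X + 6 * real N) * harm N"
proof -
  define v where "v n = u n / sqrt (real n)" for n
  have eq: "of_real (u n) * of_nat n powr (- (1/2 + \<i> * of_real t)) = of_real (v n) * cis (- (t * ln (real n)))"
    if "n \<ge> 1" for n t
  proof -
    have "- (1/2 + \<i> * of_real t) * of_real l = of_real (- l / 2) + \<i> * of_real (- (t * l))" for l
      by (simp add: complex_eq_iff)
    hence "of_nat n powr (- (1/2 + \<i> * of_real t)) = exp (of_real (- ln (real n) / 2) + \<i> * of_real (- (t * ln (real n))))"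
      using that by (simp only: powr_def Ln_of_nat) auto
    also have "\<dots> = of_real (exp (- ln (real n) / 2)) * cis (- (t * ln (real n)))"
      by (simp only: exp_add cis_conv_exp exp_of_real)
    also have "exp (- ln (real n) / 2) = 1 / sqrt (real n)"
      using that by (simp add: powr_half_sqrt[symmetric] powr_def exp_minus field_simps)
    finally show ?thesis by (simp add: v_def)
  qed
  have "integral {X..2*X} (\<lambda>t. (norm (\<Sum>n=1..N. of_real (u n) * of_nat n powr (- (1/2 + \<i> * of_real t))))\<^sup>2) =
      integral {X..2*X} (\<lambda>t. (norm (\<Sum>n=1..N. of_real (v n) * cis (- (t * ln (real n)))))\<^sup>2)"
    using eq by (intro arg_cong[where f = "integral _"] ext arg_cong[where f = "\<lambda>z. (norm z)\<^sup>2"] sum.cong) auto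
  also have "\<dots> \<le> (\<Sum>m=1..N. \<Sum>n=1..N. \<bar>v m * v n\<bar> * (if ln (real m) = ln (real n) then X else 2 / \<bar>ln (real m) - ln (real n)\<bar>))"
    by (rule integral_norm_sum_cis_squared_le[OF X]) auto
  also have "\<dots> \<le> (\<Sum>m=1..N. X * (1 / real m) + (4 * harm N + real N * (1 / real m) + harm N))"
  proof (rule sum_mono)
    fix m assume m: "m \<in> {1..N}"
    let ?t = "\<lambda>n. \<bar>v m * v n\<bar> * (if ln (real m) = ln (real n) then X else 2 / \<bar>ln (real m) - ln (real n)\<bar>)"
    have vv: "\<bar>v m * v n\<bar> \<le> 1 / (sqrt (real m) * sqrt (real n))" for n
    proof -
      have "\<bar>u m\<bar> * \<bar>u n\<bar> \<le> 1 * 1" using u by (intro mult_mono) auto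
      thus ?thesis by (simp add: v_def abs_mult divide_right_mono)
    qed
    have "(\<Sum>n=1..N. ?t n) = ?t m + (\<Sum>n\<in>{1..N} - {m}. ?t n)"
      using m by (intro sum.remove) auto
    also have "?t m \<le> X * (1 / real m)"
      using mult_left_mono[OF vv[of m], of X] X m by (simp add: mult.commute)
    also have "(\<Sum>n\<in>{1..N} - {m}. ?t n) \<le> (\<Sum>n\<in>{1..N} - {m}. 2 * (1 / \<bar>real n - real m\<bar>) + 1 / real m + 1 / real n)"
    proof (rule sum_mono)
      fix n assume n: "n \<in> {1..N} - {m}"
      have "ln (real m) \<noteq> ln (real n)" using m n by simp
      hence "?t n \<le> 1 / (sqrt (real m) * sqrt (real n)) * (2 / \<bar>ln (real m) - ln (real n)\<bar>)"
        using vv[of n] by (simp only: if_False, intro mult_right_mono) auto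
      also have "\<dots> \<le> 2 / \<bar>real m - real n\<bar> + 1 / real m + 1 / real n"
        using m n by (intro off_diagonal_le) auto
      finally show "?t n \<le> 2 * (1 / \<bar>real n - real m\<bar>) + 1 / real m + 1 / real n"
        by (simp add: abs_minus_commute)
    qed
    also have "\<dots> = 2 * (\<Sum>n\<in>{1..N} - {m}. 1 / \<bar>real n - real m\<bar>) + (\<Sum>n\<in>{1..N} - {m}. 1 / real m) + (\<Sum>n\<in>{1..N} - {m}. 1 / real n)"
      by (simp only: sum.distrib sum_distrib_left)
    also have "\<dots> \<le> 2 * (2 * harm N) + (\<Sum>n\<in>{1..N}. 1 / real m) + (\<Sum>n\<in>{1..N}. 1 / real n)"
      using m by (intro add_mono mult_left_mono sum_inverse_distance_le sum_mono2) auto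
    also have "\<dots> = 4 * harm N + real N * (1 / real m) + harm N"
      by (simp add: harm_def inverse_eq_divide)
    finally show "(\<Sum>n=1..N. ?t n) \<le> X * (1 / real m) + (4 * harm N + real N * (1 / real m) + harm N)" by simp
  qed
  also have "\<dots> = X * (\<Sum>m=1..N. 1 / real m) + real N * (4 * harm N) + real N * (\<Sum>m=1..N. 1 / real m) + real N * harm N"
    by (simp add: sum.distrib sum_distrib_left)
  also have "(\<Sum>m=1..N. 1 / real m) = harm N" by (simp add: harm_def inverse_eq_divide)
  finally show ?thesis by (simp add: algebra_simps)
qed

section \<open>From polynomials to the zeta function\<close>

lemma harm_le_ln: "harm n \<le> 1 + ln (real (max 1 n))"
proof (induction n)
  case (Suc n)
  show ?case
  proof (cases "n = 0")
    case False
    have "ln (real n / real (Suc n)) \<le> real n / real (Suc n) - 1"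
      using False by (intro ln_le_minus_one) auto
    also have "ln (real n / real (Suc n)) = ln (real n) - ln (real (Suc n))"
      using False by (simp add: ln_div)
    also have "real n / real (Suc n) - 1 = - inverse (real (Suc n))"
      by (simp add: field_simps)
    finally show ?thesis using Suc False by (simp add: harm_Suc max_def del: of_nat_Suc)
  qed (simp add: harm_def)
qed (simp add: harm_def)

lemma continuous_on_zeta_critical_line:
  "A \<subseteq> {0<..} \<Longrightarrow> continuous_on A (\<lambda>t. riemann_zeta (1/2 + \<i> * of_real t))"
  by (rule continuous_on_compose2[OF holomorphic_on_imp_continuous_on[OF holomorphic_riemann_zeta]])
    (auto simp: complex_eq_iff intro!: continuous_intros)

lemma mean_square_zeta:
  assumes "\<epsilon> > 0"
  shows "(\<lambda>X::real. integral {X..2*X} (\<lambda>t. (norm (riemann_zeta (1/2 + \<i> * of_real t)))\<^sup>2)) \<in> O(\<lambda>X. X powr (1 + \<epsilon>))"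
proof -
  define d where "d = \<epsilon> / 2"
  \<comment> \<open>Chosen so that d (K - 1) \<ge> 2: then (X^d)^(K-1) \<ge> X^2 \<ge> 4 X, which is
    the surplus that the second tail condition (4X)^K \<le> N^(K-1) demands of N \<ge> 4
    X^(1+d).\<close>
  define K where "K = nat \<lceil>2 + 2 / d\<rceil>"
  \<comment> \<open>The factor 4 comes from |s| + K \<le> 1/2 + 2X + K \<le> 4X for t in [X, 2X] and
    large X.\<close>
  define N where "N X = nat \<lceil>4 * X powr (1 + d)\<rceil>" for X :: real
  define c where "c = 2 * real K + (\<Sum>n. real n powr (- (3 / 2)))"
  define P where "P X t = (\<Sum>n=1..<N X. (-1) ^ n * of_nat n powr (- (1/2 + \<i> * of_real t)))" for X t :: real
  have d: "d > 0" using assms by (simp add: d_def)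
  have K: "real K \<ge> 2 + 2 / d" "K \<ge> 1"
  proof -
    show "real K \<ge> 2 + 2 / d" unfolding K_def using d by linarith
    moreover have "2 / d > 0" using d by simp
    ultimately show "K \<ge> 1" by linarith
  qed
  have dK: "d * (real K - 1) \<ge> 2"
  proof -
    have "d * (real K - 1) \<ge> d * (1 + 2 / d)" using K d by (intro mult_left_mono) auto
    thus ?thesis using d by (simp add: distrib_left)
  qed
  \<comment> \<open>Here 18 comes from (3 (p + c))^2 \<le> 9 * 2 (p^2 + c^2), and 30 from 6N with N
    \<le> 5 X^(1+d). The lower bound X \<ge> 4 is what makes 4X \<le> X^2.\<close>
  have bd: "integral {X..2*X} (\<lambda>t. (norm (riemann_zeta (1/2 + \<i> * of_real t)))\<^sup>2) \<le>
      18 * ((X + 30 * X powr (1 + d)) * (1 + ln (5 * X powr (1 + d))) + X * c\<^sup>2)"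
    if X: "X \<ge> 4" "2 * X \<ge> 1 + real K" for X
  proof -
    have N: "real (N X) \<ge> 4 * X powr (1 + d)" "real (N X) \<le> 5 * X powr (1 + d)"
    proof -
      have "X powr (1 + d) \<ge> X powr 0" using X d by (intro powr_mono) auto
      hence "X powr (1 + d) \<ge> 1" using X by simp
      thus "real (N X) \<ge> 4 * X powr (1 + d)" "real (N X) \<le> 5 * X powr (1 + d)"
        unfolding N_def by linarith+
    qed
    have Xd: "X \<le> X powr (1 + d)" using powr_mono[of 1 "1 + d" X] X d by simp
    have N4: "4 * X \<le> real (N X)" using N Xd by simp
    have pow: "(4 * X) ^ K \<le> real (N X) ^ (K - 1)"
    proof -
      have "4 * X \<le> X ^ 2" using X by (simp add: power2_eq_square)
      also have "\<dots> = X powr 2" using X by simp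
      also have "\<dots> \<le> X powr (d * (real K - 1))" using dK X by (intro powr_mono) auto
      also have "\<dots> = (X powr d) ^ (K - 1)"
        using X K by (simp add: powr_powr of_nat_diff flip: powr_realpow)
      finally have "(4 * X) * (4 * X) ^ (K - 1) \<le> (X powr d) ^ (K - 1) * (4 * X) ^ (K - 1)"
        using X by (intro mult_right_mono) auto
      also have "\<dots> = (4 * X powr (1 + d)) ^ (K - 1)"
        unfolding power_mult_distrib[symmetric] using X by (simp add: powr_add mult_ac)
      also have "\<dots> \<le> real (N X) ^ (K - 1)" using N by (intro power_mono) auto
      finally show ?thesis using K by (metis Suc_diff_1 less_eq_Suc_le One_nat_def power_Suc)
    qed
    have zb: "(norm (riemann_zeta (1/2 + \<i> * of_real t)))\<^sup>2 \<le> 18 * ((norm (P X t))\<^sup>2 + c\<^sup>2)"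
      if t: "t \<in> {X..2*X}" for t
    proof -
      let ?s = "1/2 + \<i> * of_real t"
      have "norm ?s \<le> 1 / 2 + t"
        using norm_triangle_ineq[of "1/2" "\<i> * of_real t"] t X by (simp add: norm_mult)
      hence s: "norm ?s + real K \<le> 4 * X" using t X by simp
      have "norm (riemann_zeta ?s) \<le> 3 * (norm (P X t) + c)"
        unfolding P_def c_def
      proof (rule norm_zeta_critical_line_le)
        have "(norm ?s + real K) ^ K \<le> (4 * X) ^ K" using s by (intro power_mono) auto
        thus "(norm ?s + real K) ^ K \<le> real (N X) ^ (K - 1)" using pow by linarith
      qed (use K s N4 in auto)
      hence "(norm (riemann_zeta ?s))\<^sup>2 \<le> (3 * (norm (P X t) + c))\<^sup>2"
        by (intro power_mono) auto
      also have "\<dots> \<le> 18 * ((norm (P X t))\<^sup>2 + c\<^sup>2)"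
        using sum_squares_ge_zero[of "norm (P X t) - c" 0] by (simp add: power2_eq_square algebra_simps)
      finally show ?thesis .
    qed
    have ci: "continuous_on {X..2*X} (\<lambda>t. (norm (P X t))\<^sup>2)"
      unfolding P_def by (intro continuous_intros) auto
    have cz: "continuous_on {X..2*X} (\<lambda>t. (norm (riemann_zeta (1/2 + \<i> * of_real t)))\<^sup>2)"
      using X by (intro continuous_intros continuous_on_zeta_critical_line) auto
    have "integral {X..2*X} (\<lambda>t. (norm (riemann_zeta (1/2 + \<i> * of_real t)))\<^sup>2) \<le>
        integral {X..2*X} (\<lambda>t. 18 * ((norm (P X t))\<^sup>2 + c\<^sup>2))"
      using zb by (intro integral_le integrable_continuous_real cz) (auto intro!: continuous_intros ci)
    also have "\<dots> = 18 * (integral {X..2*X} (\<lambda>t. (norm (P X t))\<^sup>2) + X * c\<^sup>2)"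
      using X by (simp add: Henstock_Kurzweil_Integration.integral_add integrable_continuous_real ci)
    also have "integral {X..2*X} (\<lambda>t. (norm (P X t))\<^sup>2) \<le> (X + 6 * real (N X - 1)) * harm (N X - 1)"
    proof -
      have "P X t = (\<Sum>n=1..N X - 1. of_real ((-1) ^ n) * of_nat n powr (- (1/2 + \<i> * of_real t)))" for t
        unfolding P_def using N4 X by (intro sum.cong) auto
      thus ?thesis
        using integral_norm_dirichlet_polynomial_squared_le[of X "\<lambda>n. (-1) ^ n" "N X - 1"] X
        by (simp add: power_abs)
    qed
    also have "\<dots> \<le> (X + 30 * X powr (1 + d)) * (1 + ln (5 * X powr (1 + d)))"
    proof (intro mult_mono)
      have "harm (N X - 1) \<le> 1 + ln (real (max 1 (N X - 1)))" by (rule harm_le_ln)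
      also have "\<dots> \<le> 1 + ln (5 * X powr (1 + d))"
        using N Xd X by (intro add_left_mono ln_mono) auto
      finally show "harm (N X - 1) \<le> 1 + ln (5 * X powr (1 + d))" .
    qed (use N X in \<open>auto simp: harm_nonneg\<close>)
    finally show ?thesis by simp
  qed
  \<comment> \<open>The 31 collects X + 30 X^(1+d) \<le> 31 X^(1+d); the logarithm is absorbed by ln
    X \<le> X^d/d, which brings the exponent to 1 + 2d = 1 + \<epsilon>.\<close>
  define A where "A = 18 * (31 * (1 + ln 5 + (1 + d) / d) + c\<^sup>2)"
  have "(\<lambda>X::real. integral {X..2*X} (\<lambda>t. (norm (riemann_zeta (1/2 + \<i> * of_real t)))\<^sup>2)) \<in> O(\<lambda>X. X powr (1 + 2 * d))"
  proof (rule bigoI)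
    show "\<forall>\<^sub>F X in at_top. norm (integral {X..2*X} (\<lambda>t. (norm (riemann_zeta (1/2 + \<i> * of_real t)))\<^sup>2))
      \<le> A * norm (X powr (1 + 2 * d))"
      using eventually_ge_at_top[of "4 + real K"]
    proof eventually_elim
      case (elim X)
      have X: "X \<ge> 4" using elim by simp
      have p: "X \<le> X powr (1 + d)" "X \<le> X powr (1 + 2 * d)" "1 \<le> X powr d"
        using powr_mono[of 1 "1 + d" X] powr_mono[of 1 "1 + 2 * d" X] powr_mono[of 0 d X] X d by auto
      have "1 + ln (5 * X powr (1 + d)) = 1 + ln 5 + (1 + d) * ln X"
        using X by (simp add: ln_mult ln_powr)
      also have "\<dots> \<le> (1 + ln 5) * X powr d + (1 + d) * (X powr d / d)"
        using ln_powr_bound[of X d] X d p mult_left_mono[OF p(3), of "1 + ln 5"]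
        by (intro add_mono mult_left_mono) auto
      also have "\<dots> = (1 + ln 5 + (1 + d) / d) * X powr d" by (simp add: algebra_simps)
      finally have l: "1 + ln (5 * X powr (1 + d)) \<le> (1 + ln 5 + (1 + d) / d) * X powr d" .
      have "1 + ln (5 * X powr (1 + d)) \<ge> 0"
        using p X by (intro add_nonneg_nonneg) auto
      hence "(X + 30 * X powr (1 + d)) * (1 + ln (5 * X powr (1 + d))) \<le>
          (31 * X powr (1 + d)) * ((1 + ln 5 + (1 + d) / d) * X powr d)"
        using l p by (intro mult_mono) auto
      also have "\<dots> = 31 * (1 + ln 5 + (1 + d) / d) * X powr (1 + 2 * d)"
        using powr_add[of X "1 + d" d] by (simp add: mult_ac add.assoc)
      finally have "18 * ((X + 30 * X powr (1 + d)) * (1 + ln (5 * X powr (1 + d))) + X * c\<^sup>2) \<le>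
          18 * (31 * (1 + ln 5 + (1 + d) / d) * X powr (1 + 2 * d) + X powr (1 + 2 * d) * c\<^sup>2)"
        using p by (intro mult_left_mono add_mono mult_right_mono) auto
      also have "\<dots> = A * X powr (1 + 2 * d)" by (simp add: A_def algebra_simps)
      finally have "integral {X..2*X} (\<lambda>t. (norm (riemann_zeta (1/2 + \<i> * of_real t)))\<^sup>2) \<le> A * X powr (1 + 2 * d)"
        using bd[of X] elim by simp
      moreover have "0 \<le> integral {X..2*X} (\<lambda>t. (norm (riemann_zeta (1/2 + \<i> * of_real t)))\<^sup>2)"
        using elim by (intro integral_nonneg integrable_continuous_real continuous_intros
            continuous_on_zeta_critical_line) auto
      ultimately show ?case by simp
    qed
  qed
  thus ?thesis by (simp add: d_def)
qed

section \<open>Integrability from dyadic mean values\<close>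

text \<open>On [Y 2^k, Y 2^(k+1)] the weight is at most its value at the left end, so the block is
  bounded by a constant times 2^(k (\<gamma> - p)). The blocks form a geometric series, and monotone
  convergence turns bounded integrals into integrability.\<close>

lemma set_integrable_dyadic:
  fixes f :: "real \<Rightarrow> real"
  assumes cont: "continuous_on {1..} f" and nonneg: "\<And>t. t \<ge> 1 \<Longrightarrow> f t \<ge> 0"
    and O: "(\<lambda>X. integral {X..2*X} f) \<in> O(\<lambda>X. X powr \<gamma>)" and p: "p > \<gamma>" "p \<ge> 0"
  shows "set_integrable lborel {1..} (\<lambda>t. f t * t powr (- p))"
proof -
  define g where "g t = f t * t powr (- p)" for t
  obtain M X0 where M: "\<And>X. X \<ge> X0 \<Longrightarrow> norm (integral {X..2*X} f) \<le> M * norm (X powr \<gamma>)"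
    using O by (elim landau_o.bigE) (auto simp: eventually_at_top_linorder)
  \<comment> \<open>The dyadic chain starts where the asymptotic bound is in force; the remaining
    interval [1, Y] is compact.\<close>
  define Y where "Y = max 1 X0"
  define q where "q = 2 powr (\<gamma> - p)"
  have q: "0 < q" "q < 1" using p by (auto simp: q_def powr_less_one)
  have Y: "Y \<ge> 1" "Y \<ge> X0" by (auto simp: Y_def)
  have M0: "0 \<le> \<bar>M\<bar> * Y powr (\<gamma> - p)" by simp
  have contg: "continuous_on {1..} g"
    unfolding g_def by (intro continuous_intros cont) auto
  have g0: "g t \<ge> 0" if "t \<ge> 1" for t using nonneg[OF that] by (simp add: g_def)
  have int: "g integrable_on {a..b}" "f integrable_on {a..b}" if "a \<ge> 1" for a b
    using that by (auto intro!: integrable_continuous_real continuous_on_subset[OF contg] continuous_on_subset[OF cont])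
  have Yk: "Y * 2 ^ k \<ge> Y" "Y * 2 ^ k \<ge> 1" for k
  proof -
    have "Y * 1 \<le> Y * 2 ^ k" using Y by (intro mult_left_mono) auto
    thus "Y * 2 ^ k \<ge> Y" "Y * 2 ^ k \<ge> 1" using Y by linarith+
  qed
  have block: "integral {Y * 2 ^ k..Y * 2 ^ Suc k} g \<le> (\<bar>M\<bar> * Y powr (\<gamma> - p)) * q ^ k" for k
  proof -
    let ?X = "Y * 2 ^ k"
    have X: "?X \<ge> 1" "?X \<ge> X0" using Yk[of k] Y by linarith+
    have "integral {?X..2 * ?X} g \<le> integral {?X..2 * ?X} (\<lambda>t. ?X powr (- p) * f t)"
    proof (rule integral_le)
      show "g integrable_on {?X..2 * ?X}" "(\<lambda>t. ?X powr (- p) * f t) integrable_on {?X..2 * ?X}"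
        using int X by (auto intro!: integrable_on_mult_right)
      fix t assume t: "t \<in> {?X..2 * ?X}"
      have "t powr (- p) \<le> ?X powr (- p)" using t X p by (intro powr_mono2') auto
      thus "g t \<le> ?X powr (- p) * f t"
        unfolding g_def using nonneg[of t] t X by (subst mult.commute) (intro mult_right_mono, auto)
    qed
    also have "\<dots> = ?X powr (- p) * integral {?X..2 * ?X} f" by simp
    also have "\<dots> \<le> ?X powr (- p) * (\<bar>M\<bar> * ?X powr \<gamma>)"
    proof (intro mult_left_mono)
      have "integral {?X..2 * ?X} f \<le> M * ?X powr \<gamma>" using M[OF X(2)] by simp
      also have "\<dots> \<le> \<bar>M\<bar> * ?X powr \<gamma>" by (intro mult_right_mono) auto
      finally show "integral {?X..2 * ?X} f \<le> \<bar>M\<bar> * ?X powr \<gamma>" .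
    qed auto
    also have "\<dots> = \<bar>M\<bar> * ?X powr (\<gamma> - p)" by (simp add: powr_diff powr_minus divide_simps)
    also have "?X powr (\<gamma> - p) = Y powr (\<gamma> - p) * q ^ k"
    proof -
      have "(2 ^ k) powr (\<gamma> - p) = q ^ k"
        by (simp add: q_def powr_powr mult.commute flip: powr_realpow)
      thus ?thesis using Y by (simp add: powr_mult)
    qed
    finally show ?thesis by (simp add: mult_ac)
  qed
  have le: "integral {Y..Y * 2 ^ k} g \<le> (\<bar>M\<bar> * Y powr (\<gamma> - p)) * (\<Sum>j<k. q ^ j)" for k
  proof (induction k)
    case (Suc k)
    have "integral {Y..Y * 2 ^ Suc k} g = integral {Y..Y * 2 ^ k} g + integral {Y * 2 ^ k..Y * 2 ^ Suc k} g"
      using Y Yk[of k] Yk[of "Suc k"]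
      by (intro Henstock_Kurzweil_Integration.integral_combine[symmetric] int) auto
    with Suc block[of k] show ?case by (simp add: distrib_left)
  qed simp
  have si: "set_integrable lborel {Y..Y * 2 ^ k} g" for k
    using Y by (intro borel_integrable_atLeastAtMost' continuous_on_subset[OF contg]) auto
  have L: "(LINT t|lborel. indicator {Y..Y * 2 ^ k} t *\<^sub>R g t) = integral {Y..Y * 2 ^ k} g" for k
    using set_borel_integral_eq_integral(2)[OF si] by (simp add: set_lebesgue_integral_def)
  have inc: "incseq (\<lambda>k. indicator {Y..Y * 2 ^ k} t *\<^sub>R g t)" for t
  proof (intro incseq_SucI)
    fix k
    have "Y * 2 ^ k \<le> Y * 2 ^ Suc k" using Y by simp
    thus "indicator {Y..Y * 2 ^ k} t *\<^sub>R g t \<le> indicator {Y..Y * 2 ^ Suc k} t *\<^sub>R g t"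
      using g0[of t] Y by (auto simp: indicator_def)
  qed
  have "incseq (\<lambda>k. LINT t|lborel. indicator {Y..Y * 2 ^ k} t *\<^sub>R g t)"
  proof (intro incseq_SucI integral_mono)
    fix k t
    show "integrable lborel (\<lambda>t. indicator {Y..Y * 2 ^ k} t *\<^sub>R g t)"
      "integrable lborel (\<lambda>t. indicator {Y..Y * 2 ^ Suc k} t *\<^sub>R g t)"
      using si[of k] si[of "Suc k"] unfolding set_integrable_def by blast+
    show "indicator {Y..Y * 2 ^ k} t *\<^sub>R g t \<le> indicator {Y..Y * 2 ^ Suc k} t *\<^sub>R g t"
      using inc[of t] by (rule incseq_SucD)
  qed
  moreover have "\<forall>k. (LINT t|lborel. indicator {Y..Y * 2 ^ k} t *\<^sub>R g t) \<le> (\<bar>M\<bar> * Y powr (\<gamma> - p)) * (1 / (1 - q))"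
  proof
    fix k
    have "(\<Sum>j<k. q ^ j) \<le> (\<Sum>j. q ^ j)"
      using q by (intro sum_le_suminf summable_geometric) auto
    also have "\<dots> = 1 / (1 - q)" using q by (intro suminf_geometric) auto
    finally show "(LINT t|lborel. indicator {Y..Y * 2 ^ k} t *\<^sub>R g t) \<le> (\<bar>M\<bar> * Y powr (\<gamma> - p)) * (1 / (1 - q))"
      unfolding L using le[of k] M0 by (meson mult_left_mono order_trans)
  qed
  ultimately obtain l where l: "(\<lambda>k. LINT t|lborel. indicator {Y..Y * 2 ^ k} t *\<^sub>R g t) \<longlonglongrightarrow> l"
    by (rule incseq_convergent)
  have "set_integrable lborel {Y..} g"
    unfolding set_integrable_def
  proof (rule integrable_monotone_convergence[OF _ _ _ l])
    show "integrable lborel (\<lambda>t. indicator {Y..Y * 2 ^ k} t *\<^sub>R g t)" for k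
      using si by (simp add: set_integrable_def)
    show "AE t in lborel. incseq (\<lambda>k. indicator {Y..Y * 2 ^ k} t *\<^sub>R g t)" using inc by simp
    show "AE t in lborel. (\<lambda>k. indicator {Y..Y * 2 ^ k} t *\<^sub>R g t) \<longlonglongrightarrow> indicator {Y..} t *\<^sub>R g t"
    proof (intro AE_I2 tendsto_eventually)
      fix t :: real
      have "\<forall>\<^sub>F k in sequentially. t / Y \<le> 2 ^ k"
        by real_asymp
      thus "\<forall>\<^sub>F k in sequentially. indicator {Y..Y * 2 ^ k} t *\<^sub>R g t = indicator {Y..} t *\<^sub>R g t"
        by eventually_elim (use Y in \<open>auto simp: indicator_def field_simps\<close>)
    qed
    have "continuous_on {Y..} g" using Y by (intro continuous_on_subset[OF contg]) auto
    thus "(\<lambda>t. indicator {Y..} t *\<^sub>R g t) \<in> borel_measurable lborel"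
      using borel_measurable_continuous_on_indicator[of "{Y..}" g] by simp
  qed
  moreover have "set_integrable lborel {1..Y} g"
    by (intro borel_integrable_atLeastAtMost' continuous_on_subset[OF contg]) auto
  ultimately have "set_integrable lborel ({1..Y} \<union> {Y..}) g"
    by (intro set_integrable_Un) auto
  also have "{1..Y} \<union> {Y..} = {1..}" using Y by auto
  finally show ?thesis by (simp add: g_def[abs_def])
qed

text \<open>Passes from t \<ge> 1 to the full line: |1/2 + it| dominates t, evenness handles t \<le>
  -1, and near 0 the integrand is continuous since |1/2 + it| never vanishes.\<close>

lemma integrable_even_times_norm_powr:
  fixes h :: "real \<Rightarrow> real"
  assumes cont: "continuous_on UNIV h" and nonneg: "\<And>t. h t \<ge> 0" and even: "\<And>t. h (- t) = h t"
    and int: "set_integrable lborel {1..} (\<lambda>t. h t * t powr (- p))" and p: "p \<ge> 0"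
  shows "integrable lborel (\<lambda>t. h t * norm (Complex (1 / 2) t) powr (- p))"
proof -
  define g where "g t = h t * norm (Complex (1 / 2) t) powr (- p)" for t
  have n0: "Complex (1 / 2) t \<noteq> 0" for t by (simp add: complex_eq_iff)
  have contg: "continuous_on A g" for A
    unfolding g_def using n0
    by (intro continuous_intros continuous_on_subset[OF cont]) (auto simp: Complex_eq intro!: continuous_intros)
  have 1: "set_integrable lborel {1..} g"
  proof (rule set_integrable_bound[OF int])
    show "set_borel_measurable lborel {1..} g"
      unfolding set_borel_measurable_def using borel_measurable_continuous_on_indicator[OF _ contg] by simp
    show "AE t in lborel. t \<in> {1..} \<longrightarrow> norm (g t) \<le> norm (h t * t powr (- p))"
    proof (intro AE_I2 impI)
      fix t :: real assume t: "t \<in> {1..}"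
      have "t \<le> norm (Complex (1 / 2) t)" using abs_Im_le_cmod[of "Complex (1 / 2) t"] by simp
      hence "norm (Complex (1 / 2) t) powr (- p) \<le> t powr (- p)"
        using t p by (intro powr_mono2') auto
      thus "norm (g t) \<le> norm (h t * t powr (- p))"
        using nonneg[of t] by (simp add: g_def abs_mult mult_left_mono)
    qed
  qed
  have ge: "g (- t) = g t" for t
    using even by (simp add: g_def cmod_def)
  have 2: "set_integrable lborel {..-1} g"
  proof -
    have "integrable lborel (\<lambda>t. indicator {1..} (0 + (-1) * t) *\<^sub>R g (0 + (-1) * t))"
      using 1 unfolding set_integrable_def by (rule lborel_integrable_real_affine) auto
    moreover have "indicator {1..} (0 + (-1) * t) *\<^sub>R g (0 + (-1) * t) = indicator {..-1} t *\<^sub>R g t" for t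
      by (auto simp: indicator_def ge)
    ultimately show ?thesis by (simp add: set_integrable_def)
  qed
  have 3: "set_integrable lborel {-1..1} g"
    by (intro borel_integrable_atLeastAtMost' contg)
  have "set_integrable lborel ({..-1} \<union> {-1..1} \<union> {1..}) g"
    by (intro set_integrable_Un 1 2 3) auto
  also have "{..-1} \<union> {-1..1} \<union> {1..} = (UNIV :: real set)" by auto
  finally show ?thesis by (simp add: set_integrable_def g_def[abs_def])
qed

section \<open>A smoothed Perron formula\<close>

definition summatory :: "(nat \<Rightarrow> real) \<Rightarrow> real \<Rightarrow> real" where
  "summatory c x = (\<Sum>n | 1 \<le> n \<and> real n \<le> x. c n)"

text \<open>
  The Mellin transform of the \<open>k\<close>-th finite difference, with step \<open>h\<close>, of a Riesz mean, divided by
  \<open>h ^ k\<close>: the corresponding weight is a smoothed indicator function with values in \<open>[0, 1]\<close>.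
\<close>

definition riesz_kernel :: "real \<Rightarrow> nat \<Rightarrow> real \<Rightarrow> complex \<Rightarrow> complex" where
  "riesz_kernel h k v s = exp (s * of_real v) * (exp (s * of_real h) - 1) ^ k / (of_real h ^ k * s ^ Suc k)"

lemma riesz_kernel_altdef:
  "riesz_kernel h k v s = (exp (s * of_real v) * (exp (s * of_real h) - 1) ^ k / of_real h ^ k) / s ^ Suc k"
  by (simp add: riesz_kernel_def)

lemma norm_exp_diff_le:
  fixes s :: complex
  assumes "Re s \<le> a" "h > 0"
  shows "norm (exp (s * of_real h) - 1) \<le> exp (a * h) + 1"
proof -
  have "norm (exp (s * of_real h) - 1) \<le> exp (Re s * h) + 1"
    using norm_triangle_ineq4[of "exp (s * of_real h)" 1] by simp
  also have "\<dots> \<le> exp (a * h) + 1" using assms by simp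
  finally show ?thesis .
qed

lemma integrable_riesz_kernel_Re_2:
  assumes "h > 0" "k \<ge> 1"
  shows "integrable lborel (\<lambda>t. riesz_kernel h k v (Complex 2 t))"
  unfolding riesz_kernel_altdef
proof (rule integrable_vertical_over_power)
  fix t
  show "norm (exp (Complex 2 t * of_real v) * (exp (Complex 2 t * of_real h) - 1) ^ k / of_real h ^ k)
    \<le> exp (2 * v) * (exp (2 * h) + 1) ^ k / h ^ k"
    using norm_exp_diff_le[of "Complex 2 t" 2 h] assms
    by (auto simp: norm_divide norm_mult norm_power intro!: divide_right_mono mult_left_mono power_mono)
qed (use assms in \<open>auto intro!: continuous_intros\<close>)

lemma integral_riesz_kernel:
  assumes "h > 0" "k \<ge> 1"
  shows "(LINT t|lborel. riesz_kernel h k v (Complex 2 t)) = of_real (2 * pi * (fdiff h k (trunc_pow k) v / h ^ k))"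
proof -
  have "riesz_kernel h k v (Complex 2 t) = exp (Complex 2 t * of_real v) * (exp (Complex 2 t * of_real h) - 1) ^ k / (Complex 2 t) ^ Suc k / of_real h ^ k" for t
    by (simp add: riesz_kernel_def)
  hence "(LINT t|lborel. riesz_kernel h k v (Complex 2 t)) = of_real (2 * pi * fdiff h k (trunc_pow k) v) / of_real h ^ k"
    by (simp only: integral_divide_zero integral_exp_diff_over_power[OF assms(2)])
  thus ?thesis by simp
qed

text \<open>The n-th term of a Dirichlet series acts on the kernel as a translation of v by ln n, so
  each term can be integrated by the formula for the bare kernel.\<close>

lemma powr_times_riesz_kernel:
  "of_nat (Suc n) powr (- s) * riesz_kernel h k v s = riesz_kernel h k (v - ln (real (Suc n))) s"
proof -
  have "(of_nat (Suc n) :: complex) powr (- s) = exp (- s * of_real (ln (real (Suc n))))"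
    unfolding powr_def using Ln_of_nat[of "Suc n"] by (simp del: of_nat_Suc)
  hence "of_nat (Suc n) powr (- s) * exp (s * of_real v) = exp (s * of_real (v - ln (real (Suc n))))"
    by (simp add: right_diff_distrib flip: exp_add del: of_nat_Suc)
  thus ?thesis unfolding riesz_kernel_def by (metis mult.assoc times_divide_eq_right)
qed

lemma finite_nat_le_real: "finite {n. real (Suc n) \<le> x}"
proof (rule finite_subset)
  show "{n. real (Suc n) \<le> x} \<subseteq> {..nat \<lfloor>x\<rfloor>}"
  proof
    fix n assume "n \<in> {n. real (Suc n) \<le> x}"
    hence "real n \<le> x" by simp
    thus "n \<in> {..nat \<lfloor>x\<rfloor>}" by (simp add: le_nat_floor)
  qed
qed auto

lemma summatory_Suc: "summatory c x = (\<Sum>n | real (Suc n) \<le> x. c (Suc n))"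
proof -
  have "m \<in> {n. 1 \<le> n \<and> real n \<le> x} \<longleftrightarrow> m \<in> Suc ` {n. real (Suc n) \<le> x}" for m
    by (cases m) auto
  hence "{n. 1 \<le> n \<and> real n \<le> x} = Suc ` {n. real (Suc n) \<le> x}" by blast
  thus ?thesis unfolding summatory_def by (simp add: sum.reindex)
qed

lemma summable_dirichlet_series_at_2:
  assumes "has_dirichlet_series (\<lambda>n. of_real (c n)) (Complex 2 0) z"
  shows "summable (\<lambda>n. c (Suc n) * real (Suc n) powr (- 2))"
proof -
  have "(\<lambda>n. of_real (c (Suc n)) * of_nat (Suc n) powr (- Complex 2 0)) sums z"
    using assms by (simp add: has_dirichlet_series_def)
  moreover have "of_real (c (Suc n)) * (of_nat (Suc n) :: complex) powr (- Complex 2 0) = of_real (c (Suc n) * real (Suc n) powr (- 2))" for n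
  proof -
    have "- Complex 2 0 = of_real (- 2)" by (simp add: complex_eq_iff)
    hence "(of_nat (Suc n) :: complex) powr (- Complex 2 0) = of_real (real (Suc n) powr (- 2))"
      using powr_of_real[of "real (Suc n)" "- 2"] by (simp del: of_nat_Suc)
    thus ?thesis by simp
  qed
  ultimately have "summable (\<lambda>n. complex_of_real (c (Suc n) * real (Suc n) powr (- 2)))"
    by (simp only: sums_iff)
  thus ?thesis by (simp only: summable_complex_of_real)
qed

text \<open>Integrating term by term weights c(n) by W(v - ln n), which is 1 for n \<le> e^v, 0 for
  n \<ge> e^(v + kh), and in [0, 1] between. Nonnegativity of c then yields the sandwich.\<close>

lemma integral_dirichlet_series_riesz_kernel:
  assumes c: "\<And>n. c n \<ge> 0"
    and Z: "\<And>t. has_dirichlet_series (\<lambda>n. of_real (c n)) (Complex 2 t) (Z (Complex 2 t))"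
    and h: "h > 0" and k: "k \<ge> 1"
  shows "\<exists>r. (LINT t|lborel. Z (Complex 2 t) * riesz_kernel h k v (Complex 2 t)) = of_real (2 * pi * r) \<and>
    summatory c (exp v) \<le> r \<and> r \<le> summatory c (exp (v + real k * h))"
proof -
  define W where "W w = fdiff h k (trunc_pow k) w / h ^ k" for w
  have W: "0 \<le> W w" "W w \<le> 1" "w \<ge> 0 \<Longrightarrow> W w = 1" "w \<le> - (real k * h) \<Longrightarrow> W w = 0" for w
  proof -
    obtain k' where k': "k = Suc k'" using k by (cases k) auto
    show "0 \<le> W w" "W w \<le> 1" "w \<ge> 0 \<Longrightarrow> W w = 1" "w \<le> - (real k * h) \<Longrightarrow> W w = 0"
      using fdiff_trunc_pow_bounds[OF h, of k' w] h unfolding W_def k'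
      by (auto simp: divide_le_eq_1 simp del: fdiff.simps power_Suc of_nat_Suc)
  qed
  define f where "f n t = of_real (c (Suc n)) * (of_nat (Suc n) powr (- Complex 2 t) * riesz_kernel h k v (Complex 2 t))" for n t
  note sm = summable_dirichlet_series_at_2[OF Z[of 0]]
  have feq: "f n t = of_real (c (Suc n)) * riesz_kernel h k (v - ln (real (Suc n))) (Complex 2 t)" for n t
    unfolding f_def by (simp only: powr_times_riesz_kernel)
  \<comment> \<open>On a vertical line |n^(-s)| does not depend on t, so the norm separates into a
    summable factor in n and an integrable one in t; this permits the interchange of sum and
    integral.\<close>
  have nf: "norm (f n t) = (c (Suc n) * real (Suc n) powr (- 2)) * norm (riesz_kernel h k v (Complex 2 t))" for n t
    unfolding f_def norm_mult norm_Suc_powr using c[of "Suc n"] by simp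
  have "(\<lambda>n. LINT t|lborel. f n t) sums (LINT t|lborel. (\<Sum>n. f n t))"
  proof (rule sums_integral)
    show "integrable lborel (f n)" for n
      unfolding feq[abs_def] by (intro integrable_mult_right integrable_riesz_kernel_Re_2 h k)
    show "AE t in lborel. summable (\<lambda>n. norm (f n t))"
      unfolding nf by (intro AE_I2 summable_mult2 sm)
    show "summable (\<lambda>n. LINT t|lborel. norm (f n t))"
      unfolding nf by (simp add: summable_mult2 sm del: of_nat_Suc)
  qed
  moreover have "(\<Sum>n. f n t) = Z (Complex 2 t) * riesz_kernel h k v (Complex 2 t)" for t
  proof -
    have "(\<lambda>n. (of_real (c (Suc n)) * of_nat (Suc n) powr (- Complex 2 t)) * riesz_kernel h k v (Complex 2 t)) sums
        (Z (Complex 2 t) * riesz_kernel h k v (Complex 2 t))"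
      using Z[of t] unfolding has_dirichlet_series_def by (rule sums_mult2)
    thus ?thesis unfolding f_def by (simp add: sums_iff mult.assoc)
  qed
  moreover have "(LINT t|lborel. f n t) = of_real (2 * pi * (c (Suc n) * W (v - ln (real (Suc n)))))" for n
    unfolding feq W_def using integral_riesz_kernel[OF h k, of "v - ln (real (Suc n))"] by simp
  ultimately have sums: "(\<lambda>n. of_real (2 * pi * (c (Suc n) * W (v - ln (real (Suc n)))))) sums
      (LINT t|lborel. Z (Complex 2 t) * riesz_kernel h k v (Complex 2 t))"
    by simp
  define g where "g n = c (Suc n) * W (v - ln (real (Suc n)))" for n
  define B where "B = {n. real (Suc n) \<le> exp (v + real k * h)}"
  define A where "A = {n. real (Suc n) \<le> exp v}"
  have fin: "finite A" "finite B" unfolding A_def B_def by (rule finite_nat_le_real)+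
  have g0: "g n = 0" if "n \<notin> B" for n
  proof -
    have "exp (v + real k * h) < real (Suc n)" using that by (simp add: B_def)
    hence "v + real k * h < ln (real (Suc n))" by (metis exp_gt_zero ln_exp ln_less_cancel_iff order_less_trans)
    thus ?thesis using W(4)[of "v - ln (real (Suc n))"] by (simp add: g_def)
  qed
  hence "(\<lambda>n. complex_of_real (2 * pi * g n)) sums (\<Sum>n\<in>B. of_real (2 * pi * g n))"
    by (intro sums_finite fin) auto
  with sums have "(LINT t|lborel. Z (Complex 2 t) * riesz_kernel h k v (Complex 2 t)) = (\<Sum>n\<in>B. of_real (2 * pi * g n))"
    unfolding g_def by (rule sums_unique2)
  hence "(LINT t|lborel. Z (Complex 2 t) * riesz_kernel h k v (Complex 2 t)) = of_real (2 * pi * (\<Sum>n\<in>B. g n))"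
    by (simp add: sum_distrib_left)
  moreover have "(\<Sum>n\<in>B. g n) \<le> (\<Sum>n\<in>B. c (Suc n))"
    unfolding g_def using W(2) c by (intro sum_mono mult_left_le) auto
  moreover have "(\<Sum>n\<in>A. c (Suc n)) \<le> (\<Sum>n\<in>B. g n)"
  proof -
    have "exp v \<le> exp (v + real k * h)" using h by simp
    hence "A \<subseteq> B" unfolding A_def B_def using order_trans by blast
    have "(\<Sum>n\<in>A. c (Suc n)) = (\<Sum>n\<in>A. g n)"
    proof (rule sum.cong)
      fix n assume "n \<in> A"
      hence "real (Suc n) \<le> exp v" by (simp add: A_def)
      hence "ln (real (Suc n)) \<le> v" by (metis ln_exp ln_mono of_nat_0_less_iff zero_less_Suc exp_gt_zero)
      thus "c (Suc n) = g n" using W(3)[of "v - ln (real (Suc n))"] by (simp add: g_def)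
    qed auto
    also have "\<dots> \<le> (\<Sum>n\<in>B. g n)"
      using \<open>A \<subseteq> B\<close> fin c W(1) by (intro sum_mono2) (auto simp: g_def)
    finally show ?thesis .
  qed
  ultimately show ?thesis unfolding summatory_Suc A_def B_def by blast
qed

section \<open>Bounds for the kernel\<close>

lemma norm_exp_minus_one_le:
  fixes z :: complex
  assumes "norm z \<le> 1"
  shows "norm (exp z - 1) \<le> 4 * norm z"
proof -
  have "norm (exp z - exp 0) \<le> exp 1 * norm (z - 0)"
  proof (rule field_differentiable_bound[of "cball 0 1"])
    fix w :: complex assume "w \<in> cball 0 1"
    hence "Re w \<le> 1" using complex_Re_le_cmod[of w] by simp
    thus "norm (exp w) \<le> exp 1" by simp
  qed (use assms in \<open>auto intro!: derivative_eq_intros\<close>)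
  also have "\<dots> \<le> 4 * norm (z - 0)" using exp_le by (intro mult_right_mono) auto
  finally show ?thesis by simp
qed

text \<open>With y = T/|s|, the k-th power in the kernel is at most 4^k if y \<ge> 1, because
  |e^(s/T) - 1| \<le> 4/y, and at most (4y)^k if y < 1, by the trivial bound e + 1 \<le> 4. In both
  cases y^\<beta> may be inserted for any \<beta> between 0 and k.\<close>

lemma norm_riesz_kernel_critical_line_le:
  assumes s: "Re s = 1 / 2" and T: "T \<ge> 1" and b: "0 \<le> \<beta>" "\<beta> \<le> real k"
  shows "norm (riesz_kernel (1 / T) k v s) \<le> exp (v / 2) * 4 ^ k * T powr \<beta> * norm s powr (- 1 - \<beta>)"
proof -
  have "s \<noteq> 0" using s by auto
  hence s0: "norm s > 0" by simp
  have ns1: "norm s powr (- 1) = 1 / norm s" using s0 by (simp add: powr_minus_divide)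
  define y where "y = T / norm s"
  have y: "y > 0" using T s0 by (simp add: y_def)
  have *: "(norm (exp (s * of_real (1 / T)) - 1) * y) ^ k \<le> 4 ^ k * y powr \<beta>"
  proof (cases "y \<ge> 1")
    case True
    have "norm (s * of_real (1 / T)) = 1 / y" using T by (simp add: y_def norm_mult norm_divide)
    hence "norm (exp (s * of_real (1 / T)) - 1) \<le> 4 * (1 / y)"
      using norm_exp_minus_one_le[of "s * of_real (1 / T)"] True by simp
    hence "norm (exp (s * of_real (1 / T)) - 1) * y \<le> 4 * (1 / y) * y" using y by (intro mult_right_mono) auto
    hence "norm (exp (s * of_real (1 / T)) - 1) * y \<le> 4" using y by simp
    hence "(norm (exp (s * of_real (1 / T)) - 1) * y) ^ k \<le> 4 ^ k * 1" using y by (simp add: power_mono)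
    also have "\<dots> \<le> 4 ^ k * y powr \<beta>" using True b by (intro mult_left_mono ge_one_powr_ge_zero) auto
    finally show ?thesis .
  next
    case False
    have "exp (1 / 2 * (1 / T)) \<le> exp (1::real)" using T by (simp add: divide_simps)
    also have "exp (1::real) \<le> 3" by (rule exp_le)
    finally have "norm (exp (s * of_real (1 / T)) - 1) \<le> 4"
      using norm_exp_diff_le[of s "1/2" "1 / T"] s T by simp
    hence "(norm (exp (s * of_real (1 / T)) - 1) * y) ^ k \<le> (4 * y) ^ k"
      using y by (intro power_mono mult_right_mono) auto
    also have "\<dots> = 4 ^ k * y powr real k" using y by (simp add: power_mult_distrib powr_realpow)
    also have "\<dots> \<le> 4 ^ k * y powr \<beta>" using y False b by (intro mult_left_mono powr_mono') auto
    finally show ?thesis .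
  qed
  have "norm (riesz_kernel (1 / T) k v s) = exp (v / 2) * (norm (exp (s * of_real (1 / T)) - 1) * y) ^ k / norm s"
    using s T by (simp add: riesz_kernel_def y_def norm_mult norm_divide norm_power power_mult_distrib power_divide mult_ac)
  also have "\<dots> \<le> exp (v / 2) * (4 ^ k * y powr \<beta>) / norm s"
    using * by (intro divide_right_mono mult_left_mono) auto
  also have "y powr \<beta> = T powr \<beta> * norm s powr (- \<beta>)"
    using s0 T by (simp add: y_def powr_divide powr_minus_divide)
  also have "exp (v / 2) * (4 ^ k * (T powr \<beta> * norm s powr (- \<beta>))) / norm s =
      exp (v / 2) * 4 ^ k * T powr \<beta> * (norm s powr (- 1) * norm s powr (- \<beta>))"
    unfolding ns1 by simp
  also have "norm s powr (- 1) * norm s powr (- \<beta>) = norm s powr (- 1 - \<beta>)"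
    by (simp only: powr_add[symmetric] add_uminus_conv_diff)
  finally show ?thesis .
qed

text \<open>A crude bound, uniform in the strip, for the horizontal sides; the damping factor there
  makes any constant good enough.\<close>

lemma norm_riesz_kernel_le:
  assumes "0 \<le> Re s" "Re s \<le> 2" "norm s \<ge> 1" "h > 0"
  shows "norm (riesz_kernel h k v s) \<le> exp (2 * \<bar>v\<bar>) * (exp (2 * h) + 1) ^ k / h ^ k"
proof -
  have "Re s * v \<le> Re s * \<bar>v\<bar>" using assms by (intro mult_left_mono) auto
  also have "\<dots> \<le> 2 * \<bar>v\<bar>" using assms by (intro mult_right_mono) auto
  finally have v: "Re s * v \<le> 2 * \<bar>v\<bar>" .
  have "norm (riesz_kernel h k v s) = exp (Re s * v) * norm (exp (s * of_real h) - 1) ^ k / (h ^ k * norm s ^ Suc k)"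
    using assms by (simp add: riesz_kernel_def norm_mult norm_divide norm_power)
  also have "\<dots> \<le> exp (2 * \<bar>v\<bar>) * (exp (2 * h) + 1) ^ k / (h ^ k * 1)"
    using v norm_exp_diff_le[of s 2 h] assms one_le_power[of "norm s" "Suc k"]
    by (intro frac_le mult_mono mult_left_mono power_mono) (auto simp del: power_Suc)
  finally show ?thesis by simp
qed

section \<open>Shifting to the critical line\<close>

text \<open>Since e^(T/2) outgrows every polynomial, l e^(T/2)/4 eventually exceeds (3T)^m + T, and
  e^(-T) is left over to beat the factor T.\<close>

lemma damped_decay:
  assumes "l > 0"
  shows "((\<lambda>T::real. B * T * exp ((3 * T) ^ m) * exp (- l * exp (T / 2) / 4)) \<longlongrightarrow> 0) at_top"
proof -
  have p: "((\<lambda>T::real. (T / 2) ^ j / exp (T / 2)) \<longlongrightarrow> 0) at_top" for j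
    by (rule filterlim_compose[OF tendsto_power_div_exp_0]) real_asymp
  have "((\<lambda>T::real. 6 ^ m * ((T / 2) ^ m / exp (T / 2)) + 2 * ((T / 2) ^ 1 / exp (T / 2))) \<longlongrightarrow> 6 ^ m * 0 + 2 * 0) at_top"
    by (intro tendsto_intros p)
  hence "\<forall>\<^sub>F T in at_top. 6 ^ m * ((T / 2) ^ m / exp (T / 2)) + 2 * ((T / 2) ^ 1 / exp (T / 2)) < l / 4"
    using assms by (intro order_tendstoD(2)) auto
  hence ev: "\<forall>\<^sub>F T in at_top. (3 * T) ^ m + T \<le> l * exp (T / 2) / 4"
  proof eventually_elim
    case (elim T)
    have "(3 * T) ^ m = 6 ^ m * (T / 2) ^ m" by (subst power_mult_distrib[symmetric]) simp
    hence "6 ^ m * ((T / 2) ^ m / exp (T / 2)) + 2 * ((T / 2) ^ 1 / exp (T / 2)) = ((3 * T) ^ m + T) / exp (T / 2)"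
      by (simp add: add_divide_distrib)
    with elim have "((3 * T) ^ m + T) / exp (T / 2) < l / 4" by linarith
    thus ?case by (simp add: pos_divide_less_eq)
  qed
  have "((\<lambda>T::real. \<bar>B\<bar> * (T ^ 1 / exp T)) \<longlongrightarrow> \<bar>B\<bar> * 0) at_top"
    by (intro tendsto_intros tendsto_power_div_exp_0)
  hence lim0: "((\<lambda>T::real. \<bar>B\<bar> * (T ^ 1 / exp T)) \<longlongrightarrow> 0) at_top" by simp
  have "\<forall>\<^sub>F T in at_top. norm (B * T * exp ((3 * T) ^ m) * exp (- l * exp (T / 2) / 4)) \<le> \<bar>B\<bar> * (T ^ 1 / exp T)"
    using ev eventually_ge_at_top[of 0]
  proof eventually_elim
    case (elim T)
    have "exp ((3 * T) ^ m) * exp (- l * exp (T / 2) / 4) \<le> exp (- T)"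
      using elim(1) by (simp flip: exp_add)
    hence "(\<bar>B\<bar> * T) * (exp ((3 * T) ^ m) * exp (- l * exp (T / 2) / 4)) \<le> (\<bar>B\<bar> * T) * exp (- T)"
      using elim(2) by (intro mult_left_mono) auto
    moreover have "norm (B * T * exp ((3 * T) ^ m) * exp (- l * exp (T / 2) / 4)) =
        (\<bar>B\<bar> * T) * (exp ((3 * T) ^ m) * exp (- l * exp (T / 2) / 4))"
      using elim(2) by (simp add: abs_mult)
    moreover have "(\<bar>B\<bar> * T) * exp (- T) = \<bar>B\<bar> * (T ^ 1 / exp T)"
      by (simp add: exp_minus divide_inverse)
    ultimately show ?case by linarith
  qed
  thus ?thesis using lim0 by (rule Lim_null_comparison)
qed

text \<open>The real part of cos(s/2) is cos(Re s/2) cosh(Im s/2). Halving s keeps the angle in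
  [0, 1], below \<pi>/3, so the cosine is at least 1/2; the other factor 1/2 in the 4 comes from
  cosh.\<close>

lemma norm_exp_cos_damping_le:
  assumes "0 \<le> Re s" "Re s \<le> 2" "l \<ge> 0"
  shows "norm (exp (- of_real l * cos (s / 2))) \<le> exp (- l * exp (\<bar>Im s\<bar> / 2) / 4)"
proof -
  have "1 / 2 = cos (pi / 3)" by (simp add: cos_60)
  also have "\<dots> \<le> cos (Re s / 2)" using assms pi_gt3 by (intro cos_monotone_0_pi_le) auto
  finally have c: "1 / 2 \<le> cos (Re s / 2)" .
  have "exp (\<bar>Im s\<bar> / 2) \<le> exp (Im s / 2) + exp (- (Im s / 2))"
    using exp_ge_zero[of "Im s / 2"] exp_ge_zero[of "- (Im s / 2)"] by (cases "Im s \<ge> 0") (auto simp: abs_if)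
  with c have "1 / 2 * exp (\<bar>Im s\<bar> / 2) \<le> cos (Re s / 2) * (exp (Im s / 2) + exp (- (Im s / 2)))"
    by (intro mult_mono) auto
  hence "l * (1 / 2 * exp (\<bar>Im s\<bar> / 2)) \<le> l * (cos (Re s / 2) * (exp (Im s / 2) + exp (- (Im s / 2))))"
    using assms by (intro mult_left_mono) auto
  thus ?thesis by (simp add: Re_cos)
qed

lemma holomorphic_riesz_kernel:
  assumes "h > 0"
  shows "riesz_kernel h k v holomorphic_on {s. Re s > 0}"
  unfolding riesz_kernel_def[abs_def] using assms by (intro holomorphic_intros) auto

lemma continuous_on_vertical_line:
  assumes "f holomorphic_on {s. Re s > 0} - {1}" "a > 0" "a \<noteq> 1"
  shows "continuous_on A (\<lambda>t. f (Complex a t))"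
  using assms by (intro continuous_on_compose2[OF holomorphic_on_imp_continuous_on[OF assms(1)]] continuous_intros)
    (auto simp: complex_eq_iff)

text \<open>
  Without any polynomial bound on \<open>Z\<close> inside the strip the horizontal segments need not vanish. The
  factor \<open>exp (- l cos (s / 2))\<close> is bounded by \<open>1\<close> on the strip and decays doubly exponentially,
  which beats every finite order; after the shift, \<open>l \<rightarrow> 0\<close> by dominated convergence on the two lines.
\<close>

lemma riesz_kernel_line_shift:
  assumes Z: "Z holomorphic_on {s. Re s > 0} - {1}"
    and lim: "((\<lambda>s. Z s * (s - 1)) \<longlongrightarrow> C) (at 1)"
    and growth: "\<And>s. 1 / 2 \<le> Re s \<Longrightarrow> Re s \<le> 2 \<Longrightarrow> \<bar>Im s\<bar> \<ge> 1 \<Longrightarrow> norm (Z s) \<le> A * norm s * exp (norm s powr \<rho>)"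
    and int2: "integrable lborel (\<lambda>t. Z (Complex 2 t) * riesz_kernel h k v (Complex 2 t))"
    and int: "integrable lborel (\<lambda>t. Z (Complex (1 / 2) t) * riesz_kernel h k v (Complex (1 / 2) t))"
    and h: "h > 0"
  shows "(LINT t|lborel. Z (Complex 2 t) * riesz_kernel h k v (Complex 2 t)) =
    2 * of_real pi * (C * riesz_kernel h k v 1) + (LINT t|lborel. Z (Complex (1 / 2) t) * riesz_kernel h k v (Complex (1 / 2) t))"
proof -
  define F where "F = riesz_kernel h k v"
  define D where "D l s = exp (- of_real l * cos (s / 2))" for l :: real and s :: complex
  define f where "f l s = Z s * F s * D l s" for l s
  define I where "I l a = (LINT t|lborel. f l (Complex a t))" for l a
  \<comment> \<open>Replaces the real order \<rho>, of either sign, by a natural number; this only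
    enlarges the bound because |s| \<ge> 1 where it is used.\<close>
  define m where "m = nat \<lceil>\<rho>\<rceil>"
  define P where "P = exp (2 * \<bar>v\<bar>) * (exp (2 * h) + 1) ^ k / h ^ k"
  have P: "P \<ge> 0" using h by (simp add: P_def)
  have holF: "F holomorphic_on {s. Re s > 0}" unfolding F_def by (rule holomorphic_riesz_kernel[OF h])
  have holD: "D l holomorphic_on S" for l S unfolding D_def[abs_def] by (intro holomorphic_intros) auto
  have holf: "f l holomorphic_on {s. Re s > 0} - {1}" for l
    unfolding f_def[abs_def]
    by (intro holomorphic_intros Z holD holomorphic_on_subset[OF holF]) auto
  have D1: "norm (D l s) \<le> 1" if "0 \<le> Re s" "Re s \<le> 2" "l \<ge> 0" for l s
  proof -
    have "norm (D l s) \<le> exp (- l * exp (\<bar>Im s\<bar> / 2) / 4)"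
      unfolding D_def using that by (rule norm_exp_cos_damping_le)
    also have "\<dots> \<le> 1" using that by simp
    finally show ?thesis .
  qed
  have ZF: "integrable lborel (\<lambda>t. Z (Complex a t) * F (Complex a t))" if "a = 1 / 2 \<or> a = 2" for a
    using that int int2 unfolding F_def by blast
  have measf: "(\<lambda>t. f l (Complex a t)) \<in> borel_measurable lborel" if "a = 1 / 2 \<or> a = 2" for a l
  proof -
    have "continuous_on UNIV (\<lambda>t. f l (Complex a t))"
      using that by (intro continuous_on_vertical_line[OF holf]) auto
    thus ?thesis by (simp add: borel_measurable_continuous_onI)
  qed
  have bdf: "norm (f l (Complex a t)) \<le> norm (Z (Complex a t) * F (Complex a t))" if "a = 1 / 2 \<or> a = 2" "l \<ge> 0" for a l t
    using that D1[of "Complex a t" l] by (auto simp: f_def norm_mult intro!: mult_left_le)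
  have intf: "integrable lborel (\<lambda>t. f l (Complex a t))" if "a = 1 / 2 \<or> a = 2" "l \<ge> 0" for a l
    using bdf[OF that] by (intro Bochner_Integration.integrable_bound[OF ZF[OF that(1)] measf[OF that(1)]] AE_I2)
  have shift: "I l 2 - I l (1 / 2) = 2 * of_real pi * (C * F 1 * D l 1)" if l: "l > 0" for l
  proof -
    have "I l 2 - I l (1 / 2) = 2 * of_real pi * residue (f l) 1"
      unfolding I_def
    proof (rule vertical_line_shift)
      show "((\<lambda>T. (\<bar>A\<bar> * 3 * P) * T * exp ((3 * T) ^ m) * exp (- l * exp (T / 2) / 4)) \<longlongrightarrow> 0) at_top"
        by (rule damped_decay[OF l])
      have bd: "norm (f l s) \<le> (\<bar>A\<bar> * 3 * P) * T * exp ((3 * T) ^ m) * exp (- l * exp (T / 2) / 4)"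
        if T: "T \<ge> 1" and s: "1 / 2 \<le> Re s" "Re s \<le> 2" "\<bar>Im s\<bar> = T" for s T
      proof -
        \<comment> \<open>The upper bound is |s| \<le> Re s + |Im s| \<le> 2 + T \<le> 3T.\<close>
        have ns: "norm s \<ge> 1" "norm s \<le> 3 * T"
          using abs_Im_le_cmod[of s] cmod_le[of s] s T by auto
        have "norm s powr \<rho> \<le> norm s powr real m"
          using ns(1) real_nat_ceiling_ge[of \<rho>] by (intro powr_mono) (auto simp: m_def)
        also have "\<dots> = norm s ^ m" using ns(1) by (intro powr_realpow) linarith
        also have "\<dots> \<le> (3 * T) ^ m" using ns by (intro power_mono) auto
        finally have e: "exp (norm s powr \<rho>) \<le> exp ((3 * T) ^ m)" by simp
        have "norm (Z s) \<le> A * norm s * exp (norm s powr \<rho>)" using growth[of s] s T by simp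
        also have "\<dots> \<le> \<bar>A\<bar> * norm s * exp (norm s powr \<rho>)" by (intro mult_right_mono) auto
        also have "\<dots> \<le> \<bar>A\<bar> * (3 * T) * exp ((3 * T) ^ m)"
          using ns e T by (intro mult_mono) auto
        finally have 1: "norm (Z s) \<le> \<bar>A\<bar> * (3 * T) * exp ((3 * T) ^ m)" .
        have 2: "norm (F s) \<le> P"
          unfolding F_def P_def using s ns h by (intro norm_riesz_kernel_le) auto
        have 3: "norm (D l s) \<le> exp (- l * exp (T / 2) / 4)"
          unfolding D_def using norm_exp_cos_damping_le[of s l] s l by simp
        have "norm (f l s) \<le> (\<bar>A\<bar> * (3 * T) * exp ((3 * T) ^ m)) * P * exp (- l * exp (T / 2) / 4)"
          unfolding f_def norm_mult using 1 2 3 P T by (intro mult_mono) auto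
        thus ?thesis by (simp add: mult_ac)
      qed
      show "\<forall>\<^sub>F T in at_top. \<forall>x\<in>{1 / 2..2}.
          norm (f l (Complex x T)) \<le> (\<bar>A\<bar> * 3 * P) * T * exp ((3 * T) ^ m) * exp (- l * exp (T / 2) / 4) \<and>
          norm (f l (Complex x (- T))) \<le> (\<bar>A\<bar> * 3 * P) * T * exp ((3 * T) ^ m) * exp (- l * exp (T / 2) / 4)"
        using eventually_ge_at_top[of 1]
      proof eventually_elim
        case (elim T)
        show ?case using bd[OF elim, of "Complex x T" for x] bd[OF elim, of "Complex x (- T)" for x] elim by auto
      qed
    qed (use holf intf l in \<open>auto intro: open_halfspace_Re_gt convex_halfspace_Re_gt\<close>)
    also have "residue (f l) 1 = C * F 1 * D l 1"
    proof (rule residue_simple')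
      show "open {s. Re s > 0}" by (rule open_halfspace_Re_gt)
      show "f l holomorphic_on {s. Re s > 0} - {1}" by (rule holf)
      have "isCont F 1" using holF by (auto simp: continuous_on_eq_continuous_at[OF open_halfspace_Re_gt] dest!: holomorphic_on_imp_continuous_on)
      moreover have "isCont (D l) 1" using holD[of l UNIV] by (auto simp: continuous_on_eq_continuous_at dest!: holomorphic_on_imp_continuous_on)
      ultimately have "((\<lambda>s. (Z s * (s - 1)) * F s * D l s) \<longlongrightarrow> C * F 1 * D l 1) (at 1)"
        by (intro tendsto_intros lim) (auto simp: isCont_def)
      thus "((\<lambda>w. f l w * (w - 1)) \<longlongrightarrow> C * F 1 * D l 1) (at 1)"
        by (simp add: f_def mult_ac)
    qed auto
    finally show ?thesis .
  qed
  define l where "l n = 1 / real (Suc n)" for n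
  have l: "l \<longlonglongrightarrow> 0" "l n > 0" for n
    unfolding l_def using LIMSEQ_inverse_real_of_nat by (auto simp: inverse_eq_divide)
  have Dlim: "(\<lambda>n. D (l n) s) \<longlonglongrightarrow> 1" for s
  proof -
    have "(\<lambda>n. exp (- of_real (l n) * cos (s / 2))) \<longlonglongrightarrow> exp (- of_real 0 * cos (s / 2))"
      by (intro tendsto_intros l)
    thus ?thesis by (simp add: D_def)
  qed
  have Ilim: "(\<lambda>n. I (l n) a) \<longlonglongrightarrow> (LINT t|lborel. Z (Complex a t) * F (Complex a t))" if a: "a = 1 / 2 \<or> a = 2" for a
    unfolding I_def
  proof (rule integral_dominated_convergence)
    show "integrable lborel (\<lambda>t. norm (Z (Complex a t) * F (Complex a t)))" using ZF[OF a] by (rule integrable_norm)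
    show "(\<lambda>t. Z (Complex a t) * F (Complex a t)) \<in> borel_measurable lborel" using ZF[OF a] by (rule borel_measurable_integrable)
    show "(\<lambda>t. f (l n) (Complex a t)) \<in> borel_measurable lborel" for n by (rule measf[OF a])
    show "AE t in lborel. norm (f (l n) (Complex a t)) \<le> norm (Z (Complex a t) * F (Complex a t))" for n
      using bdf[OF a, of "l n"] l(2)[of n] by (intro AE_I2) auto
    show "AE t in lborel. (\<lambda>n. f (l n) (Complex a t)) \<longlonglongrightarrow> Z (Complex a t) * F (Complex a t)"
    proof (rule AE_I2)
      fix t
      have "(\<lambda>n. Z (Complex a t) * F (Complex a t) * D (l n) (Complex a t)) \<longlonglongrightarrow> Z (Complex a t) * F (Complex a t) * 1"
        by (intro tendsto_intros Dlim)
      thus "(\<lambda>n. f (l n) (Complex a t)) \<longlonglongrightarrow> Z (Complex a t) * F (Complex a t)" by (simp add: f_def)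
    qed
  qed
  have "(\<lambda>n. I (l n) 2 - I (l n) (1 / 2)) \<longlonglongrightarrow>
      (LINT t|lborel. Z (Complex 2 t) * F (Complex 2 t)) - (LINT t|lborel. Z (Complex (1 / 2) t) * F (Complex (1 / 2) t))"
    by (intro tendsto_diff Ilim) auto
  moreover have "(\<lambda>n. I (l n) 2 - I (l n) (1 / 2)) \<longlonglongrightarrow> 2 * of_real pi * (C * F 1 * 1)"
    unfolding shift[OF l(2)] by (intro tendsto_intros Dlim)
  ultimately have "(LINT t|lborel. Z (Complex 2 t) * F (Complex 2 t)) - (LINT t|lborel. Z (Complex (1 / 2) t) * F (Complex (1 / 2) t))
      = 2 * of_real pi * (C * F 1 * 1)"
    by (rule LIMSEQ_unique)
  thus ?thesis by (simp add: F_def algebra_simps)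
qed

section \<open>From the shifted integral to the error term\<close>

lemma exp_minus_one_le: "exp y - 1 \<le> y * exp (y::real)"
proof -
  have "1 - y \<le> exp (- y)" using exp_ge_add_one_self[of "- y"] by simp
  hence "(1 - y) * exp y \<le> exp (- y) * exp y" by (intro mult_right_mono) auto
  thus ?thesis by (simp add: algebra_simps flip: exp_add)
qed

text \<open>The sandwich is used twice: starting at ln x it bounds the sum from above, and ending at
  ln x it bounds it from below. The pole contributes C e^v times a factor 1 + O(1/T), and the
  critical line contributes sqrt x * T^\<beta> times an integral independent of x and T.\<close>

lemma summatory_bound:
  fixes Z :: "complex \<Rightarrow> complex" and C :: real
  assumes c: "\<And>n. c n \<ge> 0"
    and D: "\<And>s. Re s > 1 \<Longrightarrow> has_dirichlet_series (\<lambda>n. of_real (c n)) s (Z s)"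
    and Z: "Z holomorphic_on {s. Re s > 0} - {1}"
    and lim: "((\<lambda>s. Z s * (s - 1)) \<longlongrightarrow> of_real C) (at 1)"
    and growth: "\<And>s. 1 / 2 \<le> Re s \<Longrightarrow> Re s \<le> 2 \<Longrightarrow> \<bar>Im s\<bar> \<ge> 1 \<Longrightarrow> norm (Z s) \<le> A * norm s * exp (norm s powr \<rho>)"
    and bounded: "\<And>t. norm (Z (Complex 2 t)) \<le> A'"
    and int: "integrable lborel (\<lambda>t. norm (Z (Complex (1 / 2) t)) * norm (Complex (1 / 2) t) powr (- 1 - \<beta>))"
    and b: "\<beta> \<ge> 0"
  shows "\<exists>M. \<forall>x\<ge>1. \<forall>T\<ge>1. \<bar>summatory c x - C * x\<bar> \<le> M * (x / T + sqrt x * T powr \<beta>)"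
proof -
  \<comment> \<open>The order must reach \<beta> for the kernel bound on the critical line, and must
    be at least 1 for integrability on Re s = 2.\<close>
  define k where "k = Suc (nat \<lceil>\<beta>\<rceil>)"
  have k: "k \<ge> 1" "\<beta> \<le> real k" unfolding k_def by (auto, linarith)
  define H where "H = (LINT t|lborel. norm (Z (Complex (1 / 2) t)) * norm (Complex (1 / 2) t) powr (- 1 - \<beta>))"
  have H: "H \<ge> 0" unfolding H_def by (intro integral_nonneg_AE) auto
  have main: "\<exists>r. summatory c (exp v) \<le> r \<and> r \<le> summatory c (exp (v + real k * (1 / T))) \<and>
      \<bar>r - C * exp v * ((exp (1 / T) - 1) * T) ^ k\<bar> \<le> exp (v / 2) * (4 ^ k * H) * T powr \<beta>"
    if T: "T \<ge> 1" for v T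
  proof -
    define F where "F = riesz_kernel (1 / T) k v"
    define G where "G t = norm (Z (Complex (1 / 2) t)) * norm (Complex (1 / 2) t) powr (- 1 - \<beta>)" for t
    have h: "1 / T > 0" using T by simp
    have holF: "F holomorphic_on {s. Re s > 0} - {1}"
      unfolding F_def using holomorphic_riesz_kernel[OF h] by (rule holomorphic_on_subset) auto
    have meas: "(\<lambda>t. Z (Complex a t) * F (Complex a t)) \<in> borel_measurable lborel" if "a > 0" "a \<noteq> 1" for a
    proof -
      have "continuous_on UNIV (\<lambda>t. Z (Complex a t) * F (Complex a t))"
        by (intro continuous_intros continuous_on_vertical_line Z holF that)
      thus ?thesis by (simp add: borel_measurable_continuous_onI)
    qed
    have bdhalf: "norm (Z (Complex (1 / 2) t) * F (Complex (1 / 2) t)) \<le> (exp (v / 2) * 4 ^ k * T powr \<beta>) * G t" for t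
      using mult_left_mono[OF norm_riesz_kernel_critical_line_le[of "Complex (1 / 2) t" T \<beta> k v], of "norm (Z (Complex (1 / 2) t))"] T b k
      by (simp add: F_def G_def norm_mult mult_ac)
    have G0: "(exp (v / 2) * 4 ^ k * T powr \<beta>) * G t \<ge> 0" for t by (simp add: G_def)
    have ihalf: "integrable lborel (\<lambda>t. Z (Complex (1 / 2) t) * F (Complex (1 / 2) t))"
    proof (rule Bochner_Integration.integrable_bound)
      show "integrable lborel (\<lambda>t. (exp (v / 2) * 4 ^ k * T powr \<beta>) * G t)"
        using int unfolding G_def by (rule integrable_mult_right)
      show "AE t in lborel. norm (Z (Complex (1 / 2) t) * F (Complex (1 / 2) t)) \<le> norm ((exp (v / 2) * 4 ^ k * T powr \<beta>) * G t)"
        using bdhalf G0 by (intro AE_I2) (metis abs_of_nonneg real_norm_def)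
    qed (rule meas, auto)
    have i2: "integrable lborel (\<lambda>t. Z (Complex 2 t) * F (Complex 2 t))"
    proof (rule Bochner_Integration.integrable_bound)
      show "integrable lborel (\<lambda>t. A' * norm (F (Complex 2 t)))"
        unfolding F_def by (intro integrable_mult_right integrable_norm integrable_riesz_kernel_Re_2 h k)
      have A': "A' \<ge> 0" using bounded[of 0] norm_ge_zero order_trans by blast
      show "AE t in lborel. norm (Z (Complex 2 t) * F (Complex 2 t)) \<le> norm (A' * norm (F (Complex 2 t)))"
        using bounded A' by (intro AE_I2) (auto simp: norm_mult intro!: mult_right_mono)
    qed (rule meas, auto)
    define J where "J = (LINT t|lborel. Z (Complex (1 / 2) t) * F (Complex (1 / 2) t))"
    have "norm J \<le> (LINT t|lborel. norm (Z (Complex (1 / 2) t) * F (Complex (1 / 2) t)))"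
      unfolding J_def by (rule integral_norm_bound)
    also have "\<dots> \<le> (LINT t|lborel. (exp (v / 2) * 4 ^ k * T powr \<beta>) * G t)"
      using int unfolding G_def[symmetric]
      by (intro integral_mono integrable_norm ihalf integrable_mult_right bdhalf)
    also have "\<dots> = exp (v / 2) * (4 ^ k * H) * T powr \<beta>" by (simp add: H_def G_def)
    finally have J: "norm J \<le> exp (v / 2) * (4 ^ k * H) * T powr \<beta>" .
    obtain r where r: "(LINT t|lborel. Z (Complex 2 t) * F (Complex 2 t)) = of_real (2 * pi * r)"
      "summatory c (exp v) \<le> r" "r \<le> summatory c (exp (v + real k * (1 / T)))"
      using integral_dirichlet_series_riesz_kernel[of c Z "1 / T" k v, OF c D h k(1)] unfolding F_def by auto
    have F1: "F 1 = of_real (exp v * ((exp (1 / T) - 1) * T) ^ k)"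
      using T by (simp add: F_def riesz_kernel_def power_divide power_mult_distrib exp_of_real[symmetric])
    have "of_real (2 * pi * r) = 2 * of_real pi * (of_real C * F 1) + J"
      using riesz_kernel_line_shift[OF Z lim growth i2[unfolded F_def] ihalf[unfolded F_def] h] r(1)
      unfolding F_def J_def by simp
    hence "J = of_real (2 * pi * (r - C * exp v * ((exp (1 / T) - 1) * T) ^ k))"
      unfolding F1 by (simp add: algebra_simps)
    hence "norm J = 2 * pi * \<bar>r - C * exp v * ((exp (1 / T) - 1) * T) ^ k\<bar>"
      by (simp only: norm_of_real abs_mult) simp
    moreover have "1 * \<bar>r - C * exp v * ((exp (1 / T) - 1) * T) ^ k\<bar> \<le> 2 * pi * \<bar>r - C * exp v * ((exp (1 / T) - 1) * T) ^ k\<bar>"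
      using pi_gt3 by (intro mult_right_mono) auto
    ultimately show ?thesis using r(2,3) J by (intro exI[of _ r]) auto
  qed
  define M where "M = \<bar>C\<bar> * (real k * exp (real k)) + 4 ^ k * H"
  have "\<bar>summatory c x - C * x\<bar> \<le> M * (x / T + sqrt x * T powr \<beta>)" if x: "x \<ge> 1" and T: "T \<ge> 1" for x T
  proof -
    define E where "E = 4 ^ k * H * (sqrt x * T powr \<beta>)"
    \<comment> \<open>The smoothing factor of the kernel at the pole s = 1. Its base lies between 1
      and e^(1/T), whence 1 \<le> a \<le> e^y with y = k/T the width of the smoothing on the
      logarithmic scale.\<close>
    define a where "a = ((exp (1 / T) - 1) * T) ^ k"
    define y where "y = real k * (1 / T)"
    have y: "0 \<le> y" "y \<le> real k" using T mult_left_mono[of "1 / T" 1 "real k"] by (auto simp: y_def)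
    have a: "1 \<le> a" "a \<le> exp y"
    proof -
      have "1 / T * T \<le> (exp (1 / T) - 1) * T" using exp_ge_add_one_self[of "1 / T"] T by (intro mult_right_mono) linarith+
      hence 1: "1 \<le> (exp (1 / T) - 1) * T" using T by simp
      thus "1 \<le> a" unfolding a_def by (rule one_le_power)
      have "(exp (1 / T) - 1) * T \<le> 1 / T * exp (1 / T) * T" using exp_minus_one_le[of "1 / T"] T by (intro mult_right_mono) auto
      hence "(exp (1 / T) - 1) * T \<le> exp (1 / T)" using T by simp
      hence "a \<le> exp (1 / T) ^ k" unfolding a_def using 1 by (intro power_mono) auto
      thus "a \<le> exp y" by (simp add: y_def flip: exp_of_nat_mult)
    qed
    have sq: "exp (ln x / 2) = sqrt x" using x by (simp add: powr_half_sqrt[symmetric] powr_def)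
    have yT: "x * (real k * exp (real k)) / T \<ge> x * (y * exp y)"
    proof -
      have "y * exp y \<le> y * exp (real k)" using y by (intro mult_left_mono) auto
      hence "x * (y * exp y) \<le> x * (y * exp (real k))" by (rule mult_left_mono) (use x in simp)
      also have "\<dots> = x * (real k * exp (real k)) / T" by (simp add: y_def)
      finally show ?thesis .
    qed
    define R where "R = x * (real k * exp (real k)) / T"
    obtain r where r: "summatory c x \<le> r" "\<bar>r - C * x * a\<bar> \<le> E"
      using main[OF T, of "ln x"] x sq unfolding a_def E_def by (auto simp: mult_ac)
    have "\<bar>C * x * a - C * x\<bar> = \<bar>C\<bar> * (x * (a - 1))"
    proof -
      have "C * x * a - C * x = C * (x * (a - 1))" by (simp add: algebra_simps)
      thus ?thesis using a x by (simp add: abs_mult)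
    qed
    also have "\<dots> \<le> \<bar>C\<bar> * R"
    proof (intro mult_left_mono)
      have "a - 1 \<le> y * exp y" using a exp_minus_one_le[of y] by linarith
      hence "x * (a - 1) \<le> x * (y * exp y)" by (rule mult_left_mono) (use x in simp)
      thus "x * (a - 1) \<le> R" using yT unfolding R_def by linarith
    qed auto
    finally have up: "summatory c x \<le> C * x + \<bar>C\<bar> * R + E" using r by linarith
    \<comment> \<open>Starting at ln x - y makes the upper end of the sandwich equal to ln x, which
      gives the lower bound for the sum up to x.\<close>
    obtain r' where r': "r' \<le> summatory c x" "\<bar>r' - C * exp (ln x - y) * a\<bar> \<le> exp ((ln x - y) / 2) * (4 ^ k * H) * T powr \<beta>"
      using main[OF T, of "ln x - y"] x unfolding a_def y_def by auto
    have "exp ((ln x - y) / 2) \<le> exp (ln x / 2)" using y by simp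
    hence "exp ((ln x - y) / 2) * (4 ^ k * H) * T powr \<beta> \<le> exp (ln x / 2) * (4 ^ k * H) * T powr \<beta>"
      using H by (intro mult_right_mono) auto
    also have "\<dots> = E" unfolding sq E_def by (simp add: mult_ac)
    finally have r'': "\<bar>r' - C * exp (ln x - y) * a\<bar> \<le> E" using r'(2) by linarith
    have ey: "exp (- y) * a \<le> 1" "exp (- y) * a \<ge> exp (- y)"
    proof -
      have "exp (- y) * a \<le> exp (- y) * exp y" using a by (intro mult_left_mono) auto
      thus "exp (- y) * a \<le> 1" by (simp flip: exp_add)
      show "exp (- y) * a \<ge> exp (- y)" using a by simp
    qed
    have "\<bar>C * exp (ln x - y) * a - C * x\<bar> = \<bar>C\<bar> * (x * (1 - exp (- y) * a))"
    proof -
      have "C * exp (ln x - y) * a - C * x = - (C * (x * (1 - exp (- y) * a)))"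
        using x by (simp add: exp_diff exp_minus field_simps)
      thus ?thesis using ey x by (simp add: abs_mult)
    qed
    also have "\<dots> \<le> \<bar>C\<bar> * R"
    proof (intro mult_left_mono)
      have "1 - exp (- y) * a \<le> y" using ey exp_ge_add_one_self[of "- y"] by linarith
      also have "\<dots> \<le> y * exp y" using y by (simp add: mult_le_cancel_left1)
      finally have "x * (1 - exp (- y) * a) \<le> x * (y * exp y)" by (rule mult_left_mono) (use x in simp)
      thus "x * (1 - exp (- y) * a) \<le> R" using yT unfolding R_def by linarith
    qed auto
    finally have lo: "summatory c x \<ge> C * x - \<bar>C\<bar> * R - E" using r'' r'(1) by linarith
    have "\<bar>summatory c x - C * x\<bar> \<le> \<bar>C\<bar> * R + E" using up lo by linarith
    also have "\<bar>C\<bar> * R = \<bar>C\<bar> * (real k * exp (real k)) * (x / T)" by (simp add: R_def)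
    also have "\<dots> + E \<le> M * (x / T) + M * (sqrt x * T powr \<beta>)"
      unfolding E_def using H x T by (intro add_mono mult_right_mono) (auto simp: M_def)
    finally show ?thesis by (simp add: distrib_left)
  qed
  thus ?thesis by blast
qed

section \<open>Rankin-Selberg series\<close>

text \<open>Serves two purposes: linear growth of zeta in the strip, and its residue 1 at s =
  1.\<close>

lemma norm_zeta_minus_pole_le:
  assumes "Re s \<ge> 1 / 2" "s \<noteq> 1"
  shows "norm (riemann_zeta s - 1 / (s - 1)) \<le> norm s * (\<Sum>n. real (Suc n) powr (- (3 / 2)))"
proof -
  have "summable (\<lambda>n. real n powr (- (3 / 2)))" by (subst summable_real_powr_iff) auto
  hence sm: "summable (\<lambda>n. real (Suc n) powr (- (3 / 2)))" by (subst summable_Suc_iff)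
  have le: "norm (zeta_summand (Suc n) s) \<le> norm s * real (Suc n) powr (- (3 / 2))" for n
  proof -
    have "norm (zeta_summand (Suc n) s) \<le> norm s * real (Suc n) powr (- Re s - 1)"
      using assms by (intro norm_zeta_summand_le) auto
    also have "\<dots> \<le> norm s * real (Suc n) powr (- (3 / 2))"
      using assms by (intro mult_left_mono powr_mono) auto
    finally show ?thesis .
  qed
  have "norm (\<Sum>n. zeta_summand (Suc n) s) \<le> (\<Sum>n. norm s * real (Suc n) powr (- (3 / 2)))"
    by (rule norm_suminf_le[OF le summable_mult[OF sm]])
  also have "\<dots> = norm s * (\<Sum>n. real (Suc n) powr (- (3 / 2)))"
    by (rule suminf_mult[OF sm])
  finally show ?thesis by (simp add: riemann_zeta_def)
qed

lemma tendsto_zeta_pole: "((\<lambda>s. riemann_zeta s * (s - 1)) \<longlongrightarrow> 1) (at 1)"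
proof -
  define K where "K = (\<Sum>n. real (Suc n) powr (- (3 / 2)))"
  have "((\<lambda>s. riemann_zeta s * (s - 1) - 1) \<longlongrightarrow> 0) (at 1)"
  proof (rule Lim_null_comparison)
    show "((\<lambda>s::complex. norm s * K * norm (s - 1)) \<longlongrightarrow> 0) (at 1)"
      by (auto intro!: tendsto_eq_intros)
    have "\<forall>\<^sub>F s in at (1::complex). s \<in> {s. Re s > 1 / 2}"
      by (intro eventually_at_in_open' open_halfspace_Re_gt) auto
    moreover have "\<forall>\<^sub>F s in at (1::complex). s \<noteq> 1" by (simp add: eventually_at_filter)
    ultimately show "\<forall>\<^sub>F s in at 1. norm (riemann_zeta s * (s - 1) - 1) \<le> norm s * K * norm (s - 1)"
    proof eventually_elim
      case (elim s)
      have "riemann_zeta s * (s - 1) - 1 = (riemann_zeta s - 1 / (s - 1)) * (s - 1)"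
        using elim(2) by (simp add: left_diff_distrib)
      thus ?case using norm_zeta_minus_pole_le[of s] elim
        by (simp only: norm_mult) (intro mult_right_mono, auto simp: K_def)
    qed
  qed
  thus ?thesis by (simp add: LIM_zero_iff)
qed

text \<open>Schwarz reflection for real coefficients: the identity holds termwise for Re s > 1 and
  extends to the punctured half plane, which is connected. It makes |Z(1/2 + it)| even in t, so that
  mean values over [X, 2X] also control negative t.\<close>

lemma cnj_dirichlet_series:
  fixes Z :: "complex \<Rightarrow> complex" and c :: "nat \<Rightarrow> real"
  assumes D: "\<And>s. Re s > 1 \<Longrightarrow> has_dirichlet_series (\<lambda>n. of_real (c n)) s (Z s)"
    and Z: "Z holomorphic_on {s. Re s > 0} - {1}"
    and s: "Re s > 0" "s \<noteq> 1"
  shows "Z (cnj s) = cnj (Z s)"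
proof -
  let ?S = "{s. Re s > 0} - {1}"
  have op: "open ?S" by (intro open_Diff open_halfspace_Re_gt) auto
  have im: "cnj ` ?S = ?S"
  proof -
    have "cnj ` ?S \<subseteq> ?S" by (auto simp: complex_eq_iff)
    moreover have "z \<in> cnj ` ?S" if "z \<in> ?S" for z
      using that by (intro image_eqI[of _ _ "cnj z"]) (auto simp: complex_eq_iff)
    ultimately show ?thesis by blast
  qed
  have "(cnj \<circ> Z \<circ> cnj) s = Z s"
  proof (rule analytic_continuation_open[where f = "cnj \<circ> Z \<circ> cnj" and g = Z and s = "{s. Re s > 1}" and s' = ?S])
    show "open {s. 1 < Re s}" by (rule open_halfspace_Re_gt)
    have "(2::complex) \<in> {s. 1 < Re s}" by simp
    thus "{s. 1 < Re s} \<noteq> {}" by blast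
    show "connected ?S"
      by (intro connected_open_delete open_halfspace_Re_gt convex_connected convex_halfspace_Re_gt) auto
    show "cnj \<circ> Z \<circ> cnj holomorphic_on ?S"
      using Z op by (intro holomorphic_on_compose_cnj_cnj) (simp_all only: im)
    fix z assume z: "z \<in> {s. 1 < Re s}"
    have "(\<lambda>n. of_real (c (Suc n)) * of_nat (Suc n) powr (- cnj z)) sums Z (cnj z)"
      using D[of "cnj z"] z by (simp add: has_dirichlet_series_def)
    hence "(\<lambda>n. cnj (of_real (c (Suc n)) * of_nat (Suc n) powr (- cnj z))) sums cnj (Z (cnj z))"
      by (subst sums_cnj)
    moreover have "cnj (of_real (c (Suc n)) * of_nat (Suc n) powr (- cnj z)) = of_real (c (Suc n)) * of_nat (Suc n) powr (- z)" for n
      by (simp add: cnj_powr del: of_nat_Suc)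
    ultimately have "(\<lambda>n. of_real (c (Suc n)) * of_nat (Suc n) powr (- z)) sums cnj (Z (cnj z))"
      by (simp only:)
    moreover have "(\<lambda>n. of_real (c (Suc n)) * of_nat (Suc n) powr (- z)) sums Z z"
      using D[of z] z by (simp add: has_dirichlet_series_def)
    ultimately have "cnj (Z (cnj z)) = Z z" by (rule sums_unique2)
    thus "(cnj \<circ> Z \<circ> cnj) z = Z z" by simp
  qed (use op Z s in auto)
  thus ?thesis by (metis comp_apply complex_cnj_cnj)
qed

lemma norm_dirichlet_series_Re_2_le:
  assumes D: "has_dirichlet_series (\<lambda>n. of_real (c n)) (Complex 2 t) z"
    and c: "\<And>n. c n \<ge> 0" and sm: "summable (\<lambda>n. c (Suc n) * real (Suc n) powr (- 2))"
  shows "norm z \<le> (\<Sum>n. c (Suc n) * real (Suc n) powr (- 2))"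
proof -
  have "norm (of_real (c (Suc n)) * (of_nat (Suc n) :: complex) powr (- Complex 2 t)) \<le> c (Suc n) * real (Suc n) powr (- 2)" for n
    unfolding norm_mult norm_Suc_powr using c[of "Suc n"] by simp
  hence "norm (\<Sum>n. of_real (c (Suc n)) * (of_nat (Suc n) :: complex) powr (- Complex 2 t)) \<le> (\<Sum>n. c (Suc n) * real (Suc n) powr (- 2))"
    by (rule norm_suminf_le[OF _ sm])
  thus ?thesis using D by (simp only: has_dirichlet_series_def sums_iff)
qed

lemma Complex_half: "Complex (1 / 2) t = 1 / 2 + \<i> * of_real t"
  by (simp add: complex_eq_iff)

lemma rankin_selberg_coeff_nonneg: "rankin_selberg_coeff \<kappa> a n \<ge> 0"
  unfolding rankin_selberg_coeff_def
  by (intro mult_nonneg_nonneg sum_nonneg) (auto intro!: zero_le_power_int)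

text \<open>The weight is split unevenly as t^(-(1+e)/2) for zeta and t^(-(\<theta>+e)/2) for B,
  matching their mean squares; the exponents add up to -(1 + \<beta>). AM-GM bounds the product by
  two separately integrable functions.\<close>

lemma integrable_critical_line:
  fixes Z B :: "complex \<Rightarrow> complex"
  assumes Z: "Z holomorphic_on {s. Re s > 0} - {1}"
    and ZB: "\<And>s. Re s > 0 \<Longrightarrow> s \<noteq> 1 \<Longrightarrow> Z s = riemann_zeta s * B s"
    and cnj: "\<And>s. Re s > 0 \<Longrightarrow> s \<noteq> 1 \<Longrightarrow> Z (cnj s) = cnj (Z s)"
    and B: "B holomorphic_on {s. Re s > 0}"
    and ms: "\<And>\<epsilon>. \<epsilon> > 0 \<Longrightarrow> (\<lambda>X::real. integral {X..2*X} (\<lambda>t. (norm (B (1/2 + \<i> * of_real t)))\<^sup>2)) \<in> O(\<lambda>X. X powr (\<theta> + \<epsilon>))"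
    and th: "\<theta> \<ge> 1" and e: "e > 0"
  shows "integrable lborel (\<lambda>t. norm (Z (Complex (1 / 2) t)) * norm (Complex (1 / 2) t) powr (- 1 - ((\<theta> - 1) / 2 + e)))"
proof -
  define \<beta> where "\<beta> = (\<theta> - 1) / 2 + e"
  have b: "\<beta> > 0" using th e by (simp add: \<beta>_def add_nonneg_pos)
  define h where "h t = norm (Z (Complex (1 / 2) t))" for t
  define u where "u t = norm (riemann_zeta (1 / 2 + \<i> * of_real t))" for t
  define w where "w t = norm (B (1 / 2 + \<i> * of_real t))" for t
  have line: "Re (Complex (1 / 2) t) > 0" "Complex (1 / 2) t \<noteq> 1" for t
    by (simp_all add: complex_eq_iff)
  have huw: "h t = u t * w t" for t
    using ZB[OF line] by (simp add: h_def u_def w_def norm_mult Complex_half)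
  have cu: "continuous_on {1..} u"
    unfolding u_def by (intro continuous_intros continuous_on_zeta_critical_line) auto
  have cw: "continuous_on {1..} w"
    unfolding w_def
    by (intro continuous_on_norm continuous_on_compose2[OF holomorphic_on_imp_continuous_on[OF B]])
      (auto intro!: continuous_intros)
  have ch: "continuous_on UNIV h"
    unfolding h_def by (intro continuous_on_norm continuous_on_vertical_line[OF Z]) auto
  have 1: "set_integrable lborel {1..} (\<lambda>t. (u t)\<^sup>2 * t powr (- (1 + e)))"
  proof (rule set_integrable_dyadic)
    \<comment> \<open>Only e/2 is spent on the mean value, so that the weight exponent 1 + e is
      strictly larger, as the dyadic argument requires; the same is done for B below.\<close>
    show "(\<lambda>X. integral {X..2 * X} (\<lambda>t. (u t)\<^sup>2)) \<in> O(\<lambda>X. X powr (1 + e / 2))"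
      unfolding u_def using e by (intro mean_square_zeta) auto
  qed (use e in \<open>auto intro!: continuous_intros cu\<close>)
  have 2: "set_integrable lborel {1..} (\<lambda>t. (w t)\<^sup>2 * t powr (- (\<theta> + e)))"
  proof (rule set_integrable_dyadic)
    show "(\<lambda>X. integral {X..2 * X} (\<lambda>t. (w t)\<^sup>2)) \<in> O(\<lambda>X. X powr (\<theta> + e / 2))"
      unfolding w_def using e by (intro ms) auto
  qed (use e th in \<open>auto intro!: continuous_intros cw\<close>)
  have "set_integrable lborel {1..} (\<lambda>t. (u t)\<^sup>2 * t powr (- (1 + e)) + (w t)\<^sup>2 * t powr (- (\<theta> + e)))"
    by (rule set_integral_add(1)[OF 1 2])
  hence "set_integrable lborel {1..} (\<lambda>t. h t * t powr (- (1 + \<beta>)))"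
  proof (rule set_integrable_bound)
    have "continuous_on {1..} (\<lambda>t. h t * t powr (- (1 + \<beta>)))"
      by (intro continuous_intros continuous_on_subset[OF ch]) auto
    hence "set_borel_measurable borel {1..} (\<lambda>t. h t * t powr (- (1 + \<beta>)))"
      unfolding set_borel_measurable_def by (intro borel_measurable_continuous_on_indicator) auto
    thus "set_borel_measurable lborel {1..} (\<lambda>t. h t * t powr (- (1 + \<beta>)))"
      by (simp add: set_borel_measurable_def)
    show "AE t in lborel. t \<in> {1..} \<longrightarrow> norm (h t * t powr (- (1 + \<beta>))) \<le>
        norm ((u t)\<^sup>2 * t powr (- (1 + e)) + (w t)\<^sup>2 * t powr (- (\<theta> + e)))"
    proof (intro AE_I2 impI)
      fix t :: real assume t: "t \<in> {1..}"
      define x where "x = u t * t powr (- (1 + e) / 2)"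
      define y where "y = w t * t powr (- (\<theta> + e) / 2)"
      have x2: "x\<^sup>2 = (u t)\<^sup>2 * t powr (- (1 + e))"
        by (simp add: x_def power_mult_distrib power2_eq_square flip: powr_add)
      have y2: "y\<^sup>2 = (w t)\<^sup>2 * t powr (- (\<theta> + e))"
        by (simp add: y_def power_mult_distrib power2_eq_square flip: powr_add)
      have "t powr (- (1 + e) / 2) * t powr (- (\<theta> + e) / 2) = t powr (- (1 + \<beta>))"
      proof -
        have "- (1 + e) / 2 + - (\<theta> + e) / 2 = - (1 + \<beta>)" by (simp add: \<beta>_def field_simps)
        thus ?thesis by (simp only: powr_add[symmetric])
      qed
      hence xy: "h t * t powr (- (1 + \<beta>)) = x * y"
        by (simp add: huw x_def y_def)
      have "x * y \<ge> 0" by (simp add: x_def y_def u_def w_def)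
      moreover have "2 * (x * y) \<le> x\<^sup>2 + y\<^sup>2"
        using sum_squares_bound[of x y] by simp
      ultimately show "norm (h t * t powr (- (1 + \<beta>))) \<le>
          norm ((u t)\<^sup>2 * t powr (- (1 + e)) + (w t)\<^sup>2 * t powr (- (\<theta> + e)))"
        unfolding xy x2[symmetric] y2[symmetric] real_norm_def by linarith
    qed
  qed
  moreover have "h (- t) = h t" for t
  proof -
    have "Complex (1 / 2) (- t) = cnj (Complex (1 / 2) t)" by (simp add: complex_eq_iff)
    thus ?thesis using cnj[OF line] by (simp add: h_def)
  qed
  ultimately have "integrable lborel (\<lambda>t. h t * norm (Complex (1 / 2) t) powr (- (1 + \<beta>)))"
    using b by (intro integrable_even_times_norm_powr ch) (auto simp: h_def)
  moreover have "- 1 - ((\<theta> - 1) / 2 + e) = - (1 + \<beta>)" by (simp add: \<beta>_def)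
  ultimately show ?thesis unfolding h_def by (simp only:)
qed

theorem theorem6:
  fixes \<kappa> :: int and \<phi> :: "complex \<Rightarrow> complex" and a :: "nat \<Rightarrow> complex"
    and Z B :: "complex \<Rightarrow> complex" and b :: "nat \<Rightarrow> complex" and C \<theta> :: real
  assumes eigenform: "normalized_hecke_eigenform \<kappa> \<phi> a"
    and Z_series: "\<And>s. Re s > 1 \<Longrightarrow>
          has_dirichlet_series (\<lambda>n. of_real (rankin_selberg_coeff \<kappa> a n)) s (Z s)"
    and Z_factorization: "\<And>s. Re s > 0 \<Longrightarrow> s \<noteq> 1 \<Longrightarrow> Z s = riemann_zeta s * B s"
    and B_selberg: "selberg_class_of_degree 3 b B"
    and B_holomorphic: "B holomorphic_on {s. Re s > 0}"
    and C_residue: "residue Z 1 = of_real C"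
    and theta_ge_1: "\<theta> \<ge> 1"
    and mean_square: "\<And>\<epsilon>. \<epsilon> > 0 \<Longrightarrow>
          (\<lambda>X::real. integral {X..2*X} (\<lambda>t. (norm (B (1/2 + \<i> * of_real t)))\<^sup>2))
            \<in> O(\<lambda>X. X powr (\<theta> + \<epsilon>))"
  shows "\<forall>\<epsilon>>0. rankin_selberg_Delta \<kappa> a C \<in> O(\<lambda>x. x powr (\<theta> / (\<theta> + 1) + \<epsilon>))"
proof (intro allI impI)
  fix \<epsilon> :: real assume e: "\<epsilon> > 0"
  define c where "c = rankin_selberg_coeff \<kappa> a"
  define \<beta> where "\<beta> = (\<theta> - 1) / 2 + \<epsilon>"
  have b: "\<beta> \<ge> 0" using theta_ge_1 e by (simp add: \<beta>_def)
  have c0: "c n \<ge> 0" for n unfolding c_def by (rule rankin_selberg_coeff_nonneg)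
  have D: "has_dirichlet_series (\<lambda>n. of_real (c n)) s (Z s)" if "Re s > 1" for s
    unfolding c_def using that by (rule Z_series)
  have "(\<lambda>s. riemann_zeta s * B s) holomorphic_on {s. Re s > 0} - {1}"
    by (intro holomorphic_intros holomorphic_riemann_zeta holomorphic_on_subset[OF B_holomorphic]) auto
  hence Z: "Z holomorphic_on {s. Re s > 0} - {1}"
    by (rule holomorphic_transform) (simp add: Z_factorization)
  have "isCont B 1"
    using B_holomorphic by (auto simp: continuous_on_eq_continuous_at[OF open_halfspace_Re_gt] dest!: holomorphic_on_imp_continuous_on)
  hence "((\<lambda>s. (riemann_zeta s * (s - 1)) * B s) \<longlongrightarrow> 1 * B 1) (at 1)"
    by (intro tendsto_intros tendsto_zeta_pole) (auto simp: isCont_def)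
  moreover have "\<forall>\<^sub>F s in at 1. (riemann_zeta s * (s - 1)) * B s = Z s * (s - 1)"
  proof -
    have "\<forall>\<^sub>F s in at (1::complex). s \<in> {s. Re s > 0}"
      by (intro eventually_at_in_open' open_halfspace_Re_gt) auto
    moreover have "\<forall>\<^sub>F s in at (1::complex). s \<noteq> 1" by (simp add: eventually_at_filter)
    ultimately show ?thesis by eventually_elim (simp add: Z_factorization)
  qed
  ultimately have lim: "((\<lambda>s. Z s * (s - 1)) \<longlongrightarrow> B 1) (at 1)"
    by (simp add: tendsto_cong)
  \<comment> \<open>Since (s - 1) zeta(s) tends to 1, the residue is B(1). The product limit thus
    becomes a limit with value C, the form in which the line shift takes the pole.\<close>
  have "residue Z 1 = B 1"
    by (rule residue_simple'[OF open_halfspace_Re_gt _ Z lim]) simp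
  hence lim: "((\<lambda>s. Z s * (s - 1)) \<longlongrightarrow> of_real C) (at 1)"
    using lim C_residue by simp
  \<comment> \<open>The Selberg class axioms give B finite order after multiplication by (s - 1)^k;
    this is the growth input for the damped contour.\<close>
  obtain k G K \<rho> where G: "\<And>s. s \<noteq> 1 \<Longrightarrow> G s = (s - 1) ^ k * B s" "\<And>s. norm (G s) \<le> K * exp (norm s powr \<rho>)"
    using B_selberg unfolding selberg_class_of_degree_def by blast
  define S where "S = (\<Sum>n. real (Suc n) powr (- (3 / 2)))"
  have growth: "norm (Z s) \<le> ((1 + S) * K) * norm s * exp (norm s powr \<rho>)"
    if s: "1 / 2 \<le> Re s" "Re s \<le> 2" "\<bar>Im s\<bar> \<ge> 1" for s
  proof -
    have s1: "s \<noteq> 1" using s by auto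
    have n: "norm s \<ge> 1" "norm (s - 1) \<ge> 1"
      using abs_Im_le_cmod[of s] abs_Im_le_cmod[of "s - 1"] s by auto
    have "norm (riemann_zeta s) \<le> norm (riemann_zeta s - 1 / (s - 1)) + norm (1 / (s - 1))"
      using norm_triangle_ineq[of "riemann_zeta s - 1 / (s - 1)" "1 / (s - 1)"] by simp
    also have "\<dots> \<le> norm s * S + norm s"
    proof (rule add_mono)
      show "norm (riemann_zeta s - 1 / (s - 1)) \<le> norm s * S"
        unfolding S_def using s(1) s1 by (rule norm_zeta_minus_pole_le)
      have "1 / norm (s - 1) \<le> 1 / 1" by (rule frac_le) (use n in auto)
      hence "norm (1 / (s - 1)) \<le> 1" by (simp add: norm_divide)
      thus "norm (1 / (s - 1)) \<le> norm s" using n by linarith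
    qed
    finally have 1: "norm (riemann_zeta s) \<le> (1 + S) * norm s" by (simp add: algebra_simps)
    \<comment> \<open>For |Im s| \<ge> 1 also |s - 1| \<ge> 1, so inserting (s - 1)^k can only
      enlarge the norm and the bound for \<open>G\<close> passes to B.\<close>
    have "1 * norm (B s) \<le> norm (s - 1) ^ k * norm (B s)"
      using n by (intro mult_right_mono one_le_power) auto
    also have "\<dots> = norm (G s)" using G(1)[OF s1] by (simp add: norm_mult norm_power)
    also have "\<dots> \<le> K * exp (norm s powr \<rho>)" by (rule G(2))
    finally have 2: "norm (B s) \<le> K * exp (norm s powr \<rho>)" by simp
    have "norm (Z s) \<le> ((1 + S) * norm s) * (K * exp (norm s powr \<rho>))"
      using Z_factorization[of s] s s1 order_trans[OF norm_ge_zero 1]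
      by (simp add: norm_mult) (intro mult_mono 1 2, auto)
    thus ?thesis by (simp add: mult_ac)
  qed
  have bounded: "norm (Z (Complex 2 t)) \<le> (\<Sum>n. c (Suc n) * real (Suc n) powr (- 2))" for t
    using D[of "Complex 2 t"] summable_dirichlet_series_at_2[OF D[of "Complex 2 0"]] c0
    by (intro norm_dirichlet_series_Re_2_le) auto
  have int: "integrable lborel (\<lambda>t. norm (Z (Complex (1 / 2) t)) * norm (Complex (1 / 2) t) powr (- 1 - \<beta>))"
    unfolding \<beta>_def
    by (rule integrable_critical_line[OF Z Z_factorization cnj_dirichlet_series[OF D Z] B_holomorphic mean_square theta_ge_1 e])
  obtain M where M: "\<And>x T. x \<ge> 1 \<Longrightarrow> T \<ge> 1 \<Longrightarrow> \<bar>summatory c x - C * x\<bar> \<le> M * (x / T + sqrt x * T powr \<beta>)"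
    using summatory_bound[OF c0 D Z lim growth bounded int b] by blast
  show "rankin_selberg_Delta \<kappa> a C \<in> O(\<lambda>x. x powr (\<theta> / (\<theta> + 1) + \<epsilon>))"
  proof (rule bigoI)
    show "\<forall>\<^sub>F x in at_top. norm (rankin_selberg_Delta \<kappa> a C x) \<le> (2 * \<bar>M\<bar>) * norm (x powr (\<theta> / (\<theta> + 1) + \<epsilon>))"
      using eventually_ge_at_top[of 1]
    proof eventually_elim
      case (elim x)
      \<comment> \<open>The choice solves x/T = x^(1/2) T^((\<theta>-1)/2), so both errors have size
        x^(\<theta>/(\<theta>+1)) up to the \<epsilon> in \<beta>.\<close>
      define T where "T = x powr (1 / (\<theta> + 1))"
      define P where "P = x powr (\<theta> / (\<theta> + 1) + \<epsilon>)"
      have T: "T \<ge> 1" unfolding T_def using elim theta_ge_1 by (intro ge_one_powr_ge_zero) auto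
      have "x / T = x powr (1 - 1 / (\<theta> + 1))" using elim by (simp add: T_def powr_diff)
      also have "\<dots> \<le> P" unfolding P_def using elim theta_ge_1 e
        by (intro powr_mono) (auto simp: field_simps)
      finally have 1: "x / T \<le> P" .
      have "sqrt x * T powr \<beta> = x powr (1 / 2 + 1 / (\<theta> + 1) * \<beta>)"
        using elim by (simp add: T_def powr_powr powr_add powr_half_sqrt)
      also have "\<dots> \<le> P" unfolding P_def
      proof (rule powr_mono)
        \<comment> \<open>The \<epsilon> carried by \<beta> reappears divided by \<theta> + 1, hence
          stays below the \<epsilon> allowed in the claim.\<close>
        have "1 / 2 + 1 / (\<theta> + 1) * \<beta> = (\<theta> + \<epsilon>) / (\<theta> + 1)"
        proof -
          have "(1 / 2 + 1 / (\<theta> + 1) * \<beta>) * (\<theta> + 1) = (\<theta> + 1) / 2 + \<beta>"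
            using theta_ge_1 by (simp add: distrib_right[of "1 / 2"])
          also have "\<dots> = \<theta> + \<epsilon>" by (simp add: \<beta>_def field_simps)
          finally show ?thesis using theta_ge_1 by (simp only: eq_divide_eq) auto
        qed
        moreover have "\<epsilon> / (\<theta> + 1) \<le> \<epsilon> / 1" using theta_ge_1 e by (intro divide_left_mono) auto
        ultimately show "1 / 2 + 1 / (\<theta> + 1) * \<beta> \<le> \<theta> / (\<theta> + 1) + \<epsilon>"
          by (simp add: add_divide_distrib)
      qed (use elim in auto)
      finally have 2: "sqrt x * T powr \<beta> \<le> P" .
      have "norm (rankin_selberg_Delta \<kappa> a C x) = \<bar>summatory c x - C * x\<bar>"
        by (simp add: rankin_selberg_Delta_def summatory_def c_def)
      also have "\<dots> \<le> M * (x / T + sqrt x * T powr \<beta>)" using elim T by (rule M)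
      also have "\<dots> \<le> \<bar>M\<bar> * (x / T + sqrt x * T powr \<beta>)"
        using elim T by (intro mult_right_mono) auto
      also have "\<dots> \<le> \<bar>M\<bar> * (P + P)" using 1 2 by (intro mult_left_mono add_mono) auto
      finally show ?case by (simp add: P_def)
    qed
  qed
qed

end
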